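(* Let $d\ge 3$ be a fixed integer and $p^*=(d-1)^{-1}$. Suppose that $p=p(n)\in(0,1)$ is such that, for some constant $a>0$, $$n^{1/3}|p-p^*|\le(\log n)^a .$$ Then, for any $b>\max\{a,1/3\}$, $$\lim_{n\to\infty}P\big(n^{2/3}(\log n)^{-2a}\le L_n^{(1)}\le n^{2/3}(\log n)^b\big)=1 .$$
   Context: $d\ge3$ is fixed, $n>d$ with $nd$ even; limits are taken as $n\to\infty$ through such values. $G_n$ is a uniformly random (simple, labelled) $d$-regular graph on the vertex set $[n]=\{1,\dots,n\}$. Given $p\in(0,1)$, $q=1-p$, $G_{np}$ is the random subgraph of $G_n$ (on the vertex set $[n]$) obtained by declaring each edge of $G_n$ open with probability $p$ and closed with probability $q$, independently of all other edges, and keeping exactly the open edges. $L_n^{(1)}$ is the number of vertices of the largest connected component of $G_{np}$. *)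

theory Defs
  imports "HOL-Probability.Probability"
begin

text \<open>A simple graph on the vertex set \<open>{1..n}\<close> is represented by its edge set, a set of
  two-element subsets of \<open>{1..n}\<close>.\<close>

definition simple_graph :: "nat \<Rightarrow> nat set set \<Rightarrow> bool" where
  "simple_graph n E \<longleftrightarrow> (\<forall>e\<in>E. e \<subseteq> {1..n} \<and> card e = 2)"

definition degree :: "nat set set \<Rightarrow> nat \<Rightarrow> nat" where
  "degree E v = card {e\<in>E. v \<in> e}"

definition regular_graphs :: "nat \<Rightarrow> nat \<Rightarrow> nat set set set" where
  "regular_graphs d n = {E. simple_graph n E \<and> (\<forall>v\<in>{1..n}. degree E v = d)}"

text \<open>\<open>regular_graphs d n\<close> is finite, and it is non-empty if \<open>d < n\<close> and \<open>n * d\<close> is even.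
  Only for such \<open>n\<close> is the following the uniform distribution on it;
  \<^const>\<open>pmf_of_set\<close> is unspecified on the empty set.\<close>

definition random_regular_graph :: "nat \<Rightarrow> nat \<Rightarrow> nat set set pmf" where
  "random_regular_graph d n = pmf_of_set (regular_graphs d n)"

definition percolation :: "real \<Rightarrow> 'e set \<Rightarrow> 'e set pmf" where
  "percolation p E = map_pmf (\<lambda>is_open. {e\<in>E. is_open e}) (Pi_pmf E False (\<lambda>_. bernoulli_pmf p))"

definition percolated_regular_graph :: "nat \<Rightarrow> nat \<Rightarrow> real \<Rightarrow> nat set set pmf" where
  "percolated_regular_graph d n p = random_regular_graph d n \<bind> percolation p"

text \<open>All vertices \<open>1, ..., n\<close> are present in the percolated graph, so isolated vertices form
  components of size one: the relation is reflexive on \<open>{1..n}\<close>.\<close>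

definition connected_rel :: "nat \<Rightarrow> nat set set \<Rightarrow> (nat \<times> nat) set" where
  "connected_rel n E = {(u, v). u \<in> {1..n} \<and> v \<in> {1..n} \<and> (u, v) \<in> {(x, y). {x, y} \<in> E}\<^sup>*}"

definition components :: "nat \<Rightarrow> nat set set \<Rightarrow> nat set set" where
  "components n E = {1..n} // connected_rel n E"

definition largest_component :: "nat \<Rightarrow> nat set set \<Rightarrow> nat" where
  "largest_component n E = Max (card ` components n E)"

text \<open>Limits are taken as \<open>n\<close> tends to infinity through the values for which \<open>d\<close>-regular graphs
  on \<open>n\<close> vertices exist.\<close>

definition admissible :: "nat \<Rightarrow> nat set" where
  "admissible d = {n. d < n \<and> even (n * d)}"

end

theory Submission
  imports Defs "HOL-Real_Asymp.Real_Asymp"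
begin

text \<open>Write \<open>r = d - 1\<close>, \<open>\<epsilon> = n powr (-1/3) * (ln n) powr a\<close>, so that \<open>\<bar>p - 1 / r\<bar> \<le> \<epsilon>\<close>.

  Upper bound: exploring the cluster of a vertex edge by edge shows that in every \<open>d\<close>-regular
  graph its size is dominated by the progeny of a branching process, whence it is at least \<open>k\<close>
  with probability \<open>O(\<epsilon> + 1 / sqrt k)\<close>. A component of size \<open>k = n powr (2/3) * (ln n) powr b\<close>
  consists of \<open>k\<close> vertices with large clusters, and the expected number of those is \<open>o(k)\<close>.

  Lower bound: by monotonicity let \<open>p = 1 / r - \<epsilon>\<close>, and put \<open>l = (ln n) powr a\<close>. Explore the random
  graph and the percolation together, always revealing a uniformly random unrevealed neighbour of
  a vertex of the current cluster; the graph then stays uniform given the revealed edges, and a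
  switching shows that each given vertex is hit with probability \<open>O(1 / n)\<close>. As long as only
  \<open>s = l\<^sup>2 / \<epsilon>\<^sup>2\<close> vertices are used, collisions cost no more than a change of \<open>p\<close> by \<open>\<epsilon>\<close>, so each of
  \<open>l / \<epsilon>\<close> successive clusters reaches size \<open>1 / \<epsilon>\<^sup>2\<close> with probability at least \<open>c * \<epsilon>\<close>, while their
  expected total size \<open>O(l / \<epsilon>\<^sup>2)\<close> is much smaller than \<open>s\<close>.\<close>

section \<open>Progeny of a branching process\<close>

text \<open>The probability that \<open>m\<close> independent half-edges have at least \<open>k\<close> descendants in all, when
  each of them is open with probability \<open>p\<close> and then leads to a vertex with \<open>r\<close> further half-edges:
  the recursion processes one half-edge at a time.\<close>

fun progeny_tail :: "real \<Rightarrow> nat \<Rightarrow> nat \<Rightarrow> nat \<Rightarrow> real" where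
  "progeny_tail p r 0 m = 1"
| "progeny_tail p r (Suc k) 0 = 0"
| "progeny_tail p r (Suc k) (Suc m) =
     p * progeny_tail p r k (m + r) + (1 - p) * progeny_tail p r (Suc k) m"

section \<open>Range and monotonicity of the progeny tail\<close>

lemma progeny_tail_0_right: "k > 0 \<Longrightarrow> progeny_tail p r k 0 = 0"
  by (cases k) auto

lemma progeny_tail_rec:
  "progeny_tail p r k (Suc m) =
     p * progeny_tail p r (k - 1) (m + r) + (1 - p) * progeny_tail p r k m"
  by (cases k) auto

lemma progeny_tail_bounds:
  assumes "0 \<le> p" "p \<le> 1"
  shows "0 \<le> progeny_tail p r k m \<and> progeny_tail p r k m \<le> 1"
  using assms
proof (induction p r k m rule: progeny_tail.induct)
  case (3 p r k m)
  have a: "0 \<le> progeny_tail p r k (m + r)" "progeny_tail p r k (m + r) \<le> 1"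
    and b: "0 \<le> progeny_tail p r (Suc k) m" "progeny_tail p r (Suc k) m \<le> 1"
    using 3(1)[OF 3(3,4)] 3(2)[OF 3(3,4)] by blast+
  have "p * progeny_tail p r k (m + r) + (1 - p) * progeny_tail p r (Suc k) m \<le> 1"
    using 3(3,4) a b by (intro convex_bound_le) auto
  moreover have "0 \<le> p * progeny_tail p r k (m + r) + (1 - p) * progeny_tail p r (Suc k) m"
    using 3(3,4) a b by (intro add_nonneg_nonneg mult_nonneg_nonneg) auto
  ultimately show ?case unfolding progeny_tail.simps(3) by blast
qed auto

lemma progeny_tail_Suc_right:
  assumes "0 \<le> p" "p \<le> 1"
  shows "progeny_tail p r k m \<le> progeny_tail p r k (Suc m)"
  using assms
proof (induction p r k m rule: progeny_tail.induct)
  case (2 p r k)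
  then show ?case using progeny_tail_bounds[of p r "Suc k" 1] by auto
next
  case (3 p r k m)
  have "p * progeny_tail p r k (m + r) + (1 - p) * progeny_tail p r (Suc k) m
      \<le> p * progeny_tail p r k (Suc (m + r)) + (1 - p) * progeny_tail p r (Suc k) (Suc m)"
    by (rule add_mono[OF mult_left_mono[OF 3(1)[OF 3(3,4)]] mult_left_mono[OF 3(2)[OF 3(3,4)]]])
      (use 3(3,4) in linarith)+
  then show ?case
    using progeny_tail.simps(3)[of p r k m] progeny_tail.simps(3)[of p r k "Suc m"]
    unfolding add_Suc by linarith
qed auto

lemma progeny_tail_mono:
  assumes "0 \<le> p" "p \<le> 1" "m \<le> m'"
  shows "progeny_tail p r k m \<le> progeny_tail p r k m'"
  using lift_Suc_mono_le[of "progeny_tail p r k", OF progeny_tail_Suc_right] assms by blast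

lemma progeny_tail_Suc_left:
  assumes "0 \<le> p" "p \<le> 1"
  shows "progeny_tail p r (Suc k) m \<le> progeny_tail p r k m"
  using assms
proof (induction p r k m rule: progeny_tail.induct)
  case (1 p r m)
  then show ?case using progeny_tail_bounds[of p r 1 m] by auto
next
  case (3 p r k m)
  have "p * progeny_tail p r (Suc k) (m + r) + (1 - p) * progeny_tail p r (Suc (Suc k)) m
      \<le> p * progeny_tail p r k (m + r) + (1 - p) * progeny_tail p r (Suc k) m"
    by (rule add_mono[OF mult_left_mono[OF 3(1)[OF 3(3,4)]] mult_left_mono[OF 3(2)[OF 3(3,4)]]])
      (use 3(3,4) in linarith)+
  then show ?case
    using progeny_tail.simps(3)[of p r k m] progeny_tail.simps(3)[of p r "Suc k" m] by linarith
qed auto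

text \<open>With \<open>j\<close> descendants found so far and \<open>m\<close> half-edges left, \<open>z ^ j * s ^ m\<close> is a submartingale.\<close>

lemma progeny_tail_le:
  assumes "0 \<le> p" "p \<le> 1" "0 \<le> z" "z \<le> 1" "0 \<le> s" "s \<le> 1"
    and "s \<le> 1 - p + p * z * s ^ r"
  shows "(1 - z ^ k) * progeny_tail p r k m \<le> 1 - s ^ m"
  using assms
proof (induction p r k m rule: progeny_tail.induct)
  case (1 p r m)
  then show ?case by (simp add: power_le_one)
next
  case (3 p r k m)
  let ?a = "progeny_tail p r k (m + r)"
  have a: "0 \<le> ?a" "?a \<le> 1" using progeny_tail_bounds 3 by auto
  have "(1 - z ^ k) * ?a \<le> 1 - s ^ (m + r)" using 3 by blast
  \<comment> \<open>\<open>1 - z ^ Suc k = z * (1 - z ^ k) + (1 - z)\<close>: the induction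
    hypothesis controls the first summand, the trivial bound \<open>?a \<le> 1\<close> the
    second.\<close>
  then have "z * ((1 - z ^ k) * ?a) \<le> z * (1 - s ^ (m + r))"
    using 3 by (intro mult_left_mono) auto
  moreover have "(1 - z) * ?a \<le> (1 - z) * 1" using 3 a by (intro mult_left_mono) auto
  ultimately have "(1 - z ^ Suc k) * ?a \<le> 1 - z * s ^ (m + r)" by (simp add: algebra_simps)
  then have A: "p * ((1 - z ^ Suc k) * ?a) \<le> p * (1 - z * s ^ (m + r))"
    using 3 by (intro mult_left_mono) auto
  have "(1 - z ^ Suc k) * progeny_tail p r (Suc k) m \<le> 1 - s ^ m" using 3 by blast
  then have B: "(1 - p) * ((1 - z ^ Suc k) * progeny_tail p r (Suc k) m) \<le> (1 - p) * (1 - s ^ m)"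
    using 3 by (intro mult_left_mono) auto
  have "s ^ m * s \<le> s ^ m * (1 - p + p * z * s ^ r)"
    using 3 by (intro mult_left_mono) auto
  then have C: "p * (1 - z * s ^ (m + r)) + (1 - p) * (1 - s ^ m) \<le> 1 - s ^ Suc m"
    by (simp add: algebra_simps power_add)
  have "(1 - z ^ Suc k) * progeny_tail p r (Suc k) (Suc m)
      = p * ((1 - z ^ Suc k) * ?a) + (1 - p) * ((1 - z ^ Suc k) * progeny_tail p r (Suc k) m)"
    unfolding progeny_tail.simps(3) by algebra
  then show ?case using A B C by linarith
qed auto

text \<open>Bernoulli's inequality with a quadratic gain. Near \<open>p = 1 / r\<close> the linear
  terms almost cancel and this gain has to outweigh what is left; the coefficient 1 in place of
  Taylor's \<open>r * (r - 1) / 2\<close> is enough.\<close>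

lemma power_one_minus_ge:
  fixes t :: real
  assumes "0 \<le> t" "t \<le> 1" "r \<ge> 2"
  shows "1 - real r * t + t\<^sup>2 \<le> (1 - t) ^ r"
  using assms(3)
proof (induction r rule: dec_induct)
  case base
  then show ?case by (simp add: power2_eq_square algebra_simps)
next
  case (step r)
  have "(1 - t) * (1 - real r * t + t\<^sup>2) \<le> (1 - t) * (1 - t) ^ r"
    using step assms by (intro mult_left_mono) auto
  moreover have "t * t\<^sup>2 \<le> real r * t\<^sup>2"
    using step assms by (intro mult_right_mono) auto
  ultimately show ?case by (simp add: algebra_simps power2_eq_square)
qed

text \<open>With \<open>z = 1 - 1 / k\<close> the prefactor in \<open>progeny_tail_le\<close> costs
  at most a factor 2.\<close>

lemma half_le_one_minus_power:
  assumes "k > 0"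
  shows "1 / 2 \<le> 1 - (1 - 1 / real k) ^ k"
proof -
  have "(1 - 1 / real k) ^ k \<le> exp (- (1 / real k)) ^ k"
    using assms exp_ge_add_one_self[of "- (1 / real k)"] by (intro power_mono) auto
  also have "\<dots> = exp (-1)" using assms by (simp flip: exp_of_nat_mult)
  also have "\<dots> \<le> 1 / 2"
    using exp_ge_add_one_self[of 1] by (simp add: exp_minus field_simps)
  finally show ?thesis by simp
qed

text \<open>Take \<open>z = 1 - 1 / k\<close> and \<open>s = 1 - t\<close> in
  \<open>progeny_tail_le\<close>. The gain of order \<open>t\<^sup>2\<close> must beat
  \<open>1 / k\<close> and \<open>e * t\<close>, which dictates the two summands of
  \<open>t\<close>; Bernoulli's inequality then bounds \<open>1 - (1 - t) ^ m\<close> by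
  \<open>m * t\<close>.\<close>

lemma progeny_tail_upper:
  assumes r: "r \<ge> 2" and p: "1 / (2 * real r) \<le> p" "p \<le> 1 / real r + e" "p \<le> 1"
    and e: "0 \<le> e" and k: "k \<ge> 2"
    and t: "t = 2 / sqrt (real k) + 4 * (real r)\<^sup>2 * e" and t1: "t \<le> 1"
  shows "progeny_tail p r k m \<le> 2 * real m * t"
proof -
  define h where "h = 1 / real k"
  have h: "0 < h" "h \<le> 1 / 2" using k by (auto simp: h_def field_simps)
  have t0: "0 \<le> t" unfolding t using e by auto
  have p0: "0 < p" using p(1) r by (intro less_le_trans[OF _ p(1)]) simp
  have sq: "(1 - t) ^ r \<ge> 1 - real r * t + t\<^sup>2" by (rule power_one_minus_ge[OF t0 t1 r])
  \<comment> \<open>The first summand of \<open>t\<close>, squared, gives \<open>4 * h\<close>; the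
    second one, times \<open>t\<close>, is kept to absorb the drift.\<close>
  have tt: "t\<^sup>2 \<ge> 4 * h + 4 * (real r)\<^sup>2 * e * t"
  proof -
    have "2 / sqrt (real k) * (2 / sqrt (real k)) \<le> 2 / sqrt (real k) * t"
      unfolding t using e by (intro mult_left_mono) auto
    moreover have "2 / sqrt (real k) * (2 / sqrt (real k)) = 4 * h"
      using k by (simp add: h_def)
    moreover have "t\<^sup>2 = 2 / sqrt (real k) * t + 4 * (real r)\<^sup>2 * e * t"
      using arg_cong[OF t, of "\<lambda>x. x * t"] by (simp add: power2_eq_square algebra_simps)
    ultimately show ?thesis by linarith
  qed
  \<comment> \<open>The losses \<open>p * h\<close> and \<open>r * e * t\<close> are covered by the
    gain \<open>p * (1 - h) * t\<^sup>2\<close>, of which \<open>h \<le> 1 / 2\<close> leaves at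
    least half.\<close>
  have key: "1 - t \<le> 1 - p + p * (1 - h) * (1 - t) ^ r"
  proof -
    have "p * (1 - h) * (1 - t) ^ r \<ge> p * (1 - h) * (1 - real r * t + t\<^sup>2)"
      using sq p0 h by (intro mult_left_mono) auto
    moreover have "1 - p + p * (1 - h) * (1 - real r * t + t\<^sup>2) - (1 - t)
       = - p * h + t * (1 - p * r) + p * h * real r * t + p * (1 - h) * t\<^sup>2"
      by (simp add: algebra_simps)
    moreover have "p * h * real r * t \<ge> 0" using p0 h t0 by auto
    moreover have "p * (1 - h) * t\<^sup>2 \<ge> p * (1 / 2) * t\<^sup>2"
      using p0 h by (intro mult_right_mono mult_left_mono) auto
    moreover have "t * (1 - p * r) \<ge> t * (- (real r * e))"
      using p(2) r t0 by (intro mult_left_mono) (auto simp: field_simps)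
    moreover have "p * (1 / 2) * t\<^sup>2 \<ge> p * h + t * (real r * e)"
    proof -
      have "p * (1 / 2) * (4 * h + 4 * (real r)\<^sup>2 * e * t) \<le> p * (1 / 2) * t\<^sup>2"
        using tt p0 by (intro mult_left_mono) auto
      moreover have "p * (1 / 2) * (4 * h + 4 * (real r)\<^sup>2 * e * t)
          = 2 * (p * h) + (2 * real r * p) * (real r * e * t)"
        by (simp add: algebra_simps power2_eq_square)
      moreover have "(2 * real r * p) * (real r * e * t) \<ge> 1 * (real r * e * t)"
        using p(1) r e t0 by (intro mult_right_mono) (auto simp: field_simps)
      moreover have "p * h > 0" using p0 h by simp
      moreover have "t * (real r * e) = real r * e * t" by simp
      ultimately show ?thesis by linarith
    qed
    ultimately show ?thesis by linarith
  qed
  have "(1 - (1 - h) ^ k) * progeny_tail p r k m \<le> 1 - (1 - t) ^ m"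
    using key p0 p(3) h t0 t1 by (intro progeny_tail_le) auto
  also have "\<dots> \<le> real m * t"
    using Bernoulli_inequality[of "- t" m] t1 by simp
  finally have "(1 - (1 - h) ^ k) * progeny_tail p r k m \<le> real m * t" .
  moreover have "1 / 2 * progeny_tail p r k m \<le> (1 - (1 - h) ^ k) * progeny_tail p r k m"
    using half_le_one_minus_power[of k] k progeny_tail_bounds[of p r k m] p0 p(3)
    unfolding h_def by (intro mult_right_mono) auto
  ultimately show ?thesis by linarith
qed

text \<open>Addition theorems for \<open>x = (r - 1) * \<theta>\<close> and
  \<open>y = m * \<theta>\<close>. The identity links the sine at \<open>m + 1\<close> to those at
  \<open>m + r\<close> and \<open>m\<close>, the half-edge counts after a success and after a
  failure.\<close>

lemma sin_triple_identity:
  fixes r m :: nat and \<theta> :: real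
  assumes "r \<ge> 1"
  shows "sin (real r * \<theta>) * sin (real (Suc m) * \<theta>)
    = sin \<theta> * sin (real (m + r) * \<theta>) + sin (real (r - 1) * \<theta>) * sin (real m * \<theta>)"
proof -
  define x y where "x = real (r - 1) * \<theta>" and "y = real m * \<theta>"
  have *: "real r * \<theta> = x + \<theta>" "real (Suc m) * \<theta> = y + \<theta>" "real (m + r) * \<theta> = x + (y + \<theta>)"
    using assms by (auto simp: x_def y_def algebra_simps of_nat_diff)
  have "cos \<theta> * cos \<theta> = 1 - sin \<theta> * sin \<theta>"
    using sin_cos_squared_add[of \<theta>] by (simp add: power2_eq_square)
  then have "sin (x + \<theta>) * sin (y + \<theta>) = sin \<theta> * sin (x + (y + \<theta>)) + sin x * sin y"
    unfolding sin_add cos_add by (algebra)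
  then show ?thesis unfolding * by (simp add: x_def y_def)
qed

text \<open>\<open>Im (s ^ m) / z ^ k\<close> solves the recursion of \<^const>\<open>progeny_tail\<close> whenever
  \<open>s = 1 - p + p z s ^ r\<close>. Taking \<open>s = \<rho> e\<^sup>i\<^sup>\<theta>\<close> with \<open>z > 0\<close> real gives the two equations below,
  and cutting the sine off at its first positive zero leaves a subsolution that is bounded at
  \<open>k = 0\<close>.\<close>

lemma progeny_tail_ge_sin:
  fixes \<theta> \<rho> z C p :: real
  assumes p: "0 \<le> p" "p \<le> 1" and r: "r \<ge> 2" and \<theta>: "\<theta> > 0" "real r * \<theta> < pi"
    and \<rho>: "\<rho> > 0" and z: "z > 0"
    and eq1: "(1 - p) * sin (real r * \<theta>) = \<rho> * sin (real (r - 1) * \<theta>)"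
    and eq2: "p * z * \<rho> ^ (r - 1) * sin (real r * \<theta>) = sin \<theta>"
    and C: "\<And>m. real m * \<theta> \<le> pi \<Longrightarrow> \<rho> ^ m \<le> C"
    and m: "real m * \<theta> \<le> pi"
  shows "\<rho> ^ m * sin (real m * \<theta>) / z ^ k \<le> C * progeny_tail p r k m"
proof -
  have C0: "C \<ge> 1" using C[of 0] by simp
  have "(if real m * \<theta> \<le> pi then \<rho> ^ m * sin (real m * \<theta>) / z ^ k else 0)
      \<le> C * progeny_tail p r k m" (is "?G k m \<le> _")
    using p r \<theta>(2) eq1 eq2
  proof (induction p r k m rule: progeny_tail.induct)
    case (1 p r m)
    have "\<rho> ^ m * sin (real m * \<theta>) \<le> \<rho> ^ m * 1"
      using \<rho> by (intro mult_left_mono) auto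
    also have "\<dots> \<le> C" if "real m * \<theta> \<le> pi" using C[OF that] by simp
    finally show ?case using C0 by auto
  next
    case (2 p r k)
    then show ?case using C0 by auto
  next
    case (3 p r k m)
    let ?g = "\<lambda>k m. \<rho> ^ m * sin (real m * \<theta>) / z ^ k"
    let ?G = "\<lambda>k m. if real m * \<theta> \<le> pi then ?g k m else 0"
    have nn: "0 \<le> ?G k' m'" for k' m'
      using \<rho> z \<theta> by (auto intro!: divide_nonneg_pos mult_nonneg_nonneg sin_ge_zero)
    have IH: "?G k (m + r) \<le> C * progeny_tail p r k (m + r)"
             "?G (Suc k) m \<le> C * progeny_tail p r (Suc k) m" using 3 by auto
    have main: "?G (Suc k) (Suc m) \<le> p * ?G k (m + r) + (1 - p) * ?G (Suc k) m"
    proof (cases "real (Suc m) * \<theta> \<le> pi")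
      case True
      have m': "real m * \<theta> \<le> pi" using True \<theta> by (simp add: algebra_simps)
      have sr: "sin (real r * \<theta>) > 0" using \<theta> 3 by (intro sin_gt_zero) auto
      have "?g k (m + r) \<le> ?G k (m + r)"
      proof (cases "real (m + r) * \<theta> \<le> pi")
        case False
        \<comment> \<open>The jump to \<open>m + r\<close> overshoots \<open>pi\<close> by less than
          \<open>pi\<close>, so the sine is nonpositive wherever the cutoff replaces it by
          0.\<close>
        have "real (m + r) * \<theta> \<le> 2 * pi" using True 3 \<theta> by (simp add: algebra_simps)
        then have "sin (real (m + r) * \<theta>) \<le> 0"
          using False sin_le_zero[of "real (m + r) * \<theta>"] by (cases "real (m + r) * \<theta> = 2 * pi") auto
        then show ?thesis using False \<rho> z by (auto intro!: divide_nonpos_pos mult_nonneg_nonpos)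
      qed auto
      then have "p * ?g k (m + r) \<le> p * ?G k (m + r)" using 3 by (intro mult_left_mono) auto
      \<comment> \<open>Before the cutoff the recursion holds with equality; multiplying by
        \<open>S\<close> lets the two equations for \<open>\<rho>\<close> and \<open>z\<close> be
        inserted.\<close>
      moreover have "?g (Suc k) (Suc m) = p * ?g k (m + r) + (1 - p) * ?g (Suc k) m"
      proof -
        define S where "S = sin (real r * \<theta>)"
        have S: "S \<noteq> 0" using sr S_def by auto
        have pw: "\<rho> ^ (m + r) = \<rho> ^ Suc m * \<rho> ^ (r - 1)"
          using 3(5) by (simp flip: power_add power_Suc)
        have "S * (p * ?g k (m + r) + (1 - p) * ?g (Suc k) m)
            = \<rho> ^ Suc m / z ^ Suc k * ((p * z * \<rho> ^ (r - 1) * S) * sin (real (m + r) * \<theta>)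
               + ((1 - p) * S) / \<rho> * sin (real m * \<theta>))"
          unfolding pw using \<rho> z by (simp add: field_simps)
        also have "\<dots> = \<rho> ^ Suc m / z ^ Suc k * (sin \<theta> * sin (real (m + r) * \<theta>)
               + sin (real (r - 1) * \<theta>) * sin (real m * \<theta>))"
          using 3(7,8) \<rho> unfolding S_def by (simp add: mult.commute)
        also have "\<dots> = \<rho> ^ Suc m / z ^ Suc k * (S * sin (real (Suc m) * \<theta>))"
          using sin_triple_identity[of r \<theta> m] 3 S_def by simp
        also have "\<dots> = S * ?g (Suc k) (Suc m)" by simp
        finally show ?thesis using S by (metis mult_left_cancel)
      qed
      ultimately show ?thesis using True m' by simp
    next
      case False
      then show ?thesis using nn 3 by (simp del: of_nat_Suc of_nat_add)
    qed
    also have "\<dots> \<le> p * (C * progeny_tail p r k (m + r)) + (1 - p) * (C * progeny_tail p r (Suc k) m)"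
      using IH 3 by (intro add_mono mult_left_mono) auto
    finally show ?case by (simp add: algebra_simps)
  qed
  then show ?thesis using m by simp
qed


section \<open>Near-critical lower bound on the progeny tail\<close>

lemma sin_ge_cubic:
  fixes y :: real
  assumes "0 \<le> y"
  shows "y * (1 - y\<^sup>2 / 2) \<le> sin y"
proof (cases "y = 0")
  case False
  then have y: "0 < y" using assms by simp
  obtain x where x: "0 < x" "x < y" "sin y - sin 0 = (y - 0) * cos x"
    using MVT2[OF y, of sin cos] by auto
  have "(sin (x / 2))\<^sup>2 \<le> (x / 2)\<^sup>2"
    using abs_sin_x_le_abs_x[of "x / 2"] by (rule abs_le_square_iff[THEN iffD1])
  then have "1 - x\<^sup>2 / 2 \<le> cos x"
    using cos_double_sin[of "x / 2"] by (simp add: power_divide)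
  moreover have "x\<^sup>2 \<le> y\<^sup>2" using x by (intro power_mono) auto
  ultimately have "1 - y\<^sup>2 / 2 \<le> cos x" by simp
  then have "y * (1 - y\<^sup>2 / 2) \<le> y * cos x" using y by (intro mult_left_mono) auto
  then show ?thesis using x by simp
qed auto

text \<open>This turns \<open>1 / z \<ge> 1 - y\<close>, with \<open>y\<close> of order
  \<open>e\<^sup>2\<close>, into a bound on the \<open>k\<close>-th power when
  \<open>k \<le> 1 / e\<^sup>2\<close>.\<close>

lemma exp_le_one_minus:
  fixes y :: real
  assumes "0 \<le> y" "y \<le> 1 / 2"
  shows "exp (- 2 * y) \<le> 1 - y"
proof -
  have "2 * y\<^sup>2 \<le> y" using mult_right_mono[OF assms(2,1)] by (simp add: power2_eq_square)
  then have "- 2 * y \<le> ln (1 - y)" using ln_one_minus_pos_lower_bound[OF assms] by linarith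
  then have "exp (- 2 * y) \<le> exp (ln (1 - y))" by simp
  then show ?thesis using assms by simp
qed

text \<open>Take \<open>\<theta> = e\<close> in \<open>progeny_tail_ge_sin\<close> and solve its
  equations for \<open>\<rho>\<close> and \<open>z\<close>. Then \<open>\<rho>\<close> is
  \<open>1 + O(e)\<close>, so its powers stay bounded up to \<open>m = pi / e\<close>, and
  \<open>1 / z \<ge> 1 - O(e\<^sup>2)\<close>, so \<open>1 / z ^ k\<close> stays bounded below for
  \<open>k \<le> 1 / e\<^sup>2\<close>. What remains is \<open>sin ((r + 1) * e)\<close>, of order
  \<open>e\<close>.\<close>

lemma progeny_tail_lower:
  assumes r: "r \<ge> 2"
  obtains c e0 where "c > 0" "e0 > 0"
    "\<And>e k. \<lbrakk>0 < e; e < e0; real k * e\<^sup>2 \<le> 1\<rbrakk>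
      \<Longrightarrow> c * e \<le> progeny_tail (1 / real r - 2 * e) r k (Suc r)"
proof
  define R where "R = real r"
  have R: "R \<ge> 2" using r R_def by simp
  \<comment> \<open>\<open>C\<close> bounds \<open>\<rho> ^ m\<close> for
    \<open>m * e \<le> pi\<close>, since \<open>\<rho> \<le> exp (5 * e)\<close> below. The factors
    of \<open>c\<close> come from \<open>\<rho> ^ Suc r\<close>, from the sine and from
    \<open>1 / z ^ k\<close>, in this order.\<close>
  define C where "C = exp (5 * pi)"
  define c where "c = (1 / 2) ^ Suc r * (1 / 2) * exp (- (6 * R ^ 3)) / C"
  show "c > 0" unfolding c_def C_def by simp
  show "1 / (8 * R ^ 3) > 0" using R by simp
  fix e :: real and k :: nat
  assume e: "0 < e" "e < 1 / (8 * R ^ 3)" and k: "real k * e\<^sup>2 \<le> 1"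
  have R3: "R ^ 3 \<ge> 8" using power_mono[OF R, of 3] by simp
  have Re3: "R ^ 3 * e < 1 / 8"
    using mult_strict_left_mono[OF e(2), of "R ^ 3"] R3 R by simp
  have R23: "2 * R\<^sup>2 \<le> R ^ 3"
    using R mult_right_mono[OF R, of "R\<^sup>2"] by (simp add: power3_eq_cube power2_eq_square mult.assoc)
  have R2: "2 * R \<le> R\<^sup>2" using R by (simp add: power2_eq_square)
  have eR2: "R\<^sup>2 * e < 1 / 16"
    using mult_right_mono[OF R23, of e] e Re3 by linarith
  have eR: "R * e < 1 / 32"
    using mult_right_mono[OF R2, of e] e eR2 by linarith
  have e1: "e < 1 / 64" using mult_right_mono[OF R, of e] e eR by linarith
  define p where "p = 1 / R - 2 * e"
  \<comment> \<open>This \<open>x\<close> gives \<open>p = (1 - (R - 1) * x) / R\<close> and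
    \<open>1 - p = (R - 1) * (1 + x) / R\<close>, the form in which the first-order effects on
    \<open>z\<close> cancel.\<close>
  define x where "x = 2 * e * R / (R - 1)"
  \<comment> \<open>Dividing each sine by its argument leaves a factor between \<open>1 - u\<close>
    and 1 for \<open>0 < j \<le> r\<close>, with \<open>u\<close> of order
    \<open>e\<^sup>2\<close>.\<close>
  define S where "S = (\<lambda>j::nat. sin (real j * e) / (real j * e))"
  have x: "0 \<le> x" "x \<le> 4 * e"
    using R e by (auto simp: x_def field_simps)
  have Rx: "(R - 1) * x = 2 * e * R" using R by (simp add: x_def)
  have p_eq: "p = (1 - (R - 1) * x) / R" unfolding Rx p_def using R by (simp add: field_simps)
  have q_eq: "1 - p = (R - 1) * (1 + x) / R"
    unfolding p_def using Rx R by (simp add: field_simps)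
  have "1 / R \<le> 1 / 2" using R by simp
  then have "p \<le> 1" unfolding p_def using e by simp
  moreover have "0 < p" unfolding p_eq Rx using eR R by (intro divide_pos_pos) (auto simp: mult.commute[of e R] mult.assoc)
  ultimately have p0: "0 < p" "p \<le> 1" by auto
  have S_le: "S j \<le> 1" for j
  proof (cases "j = 0")
    case False
    then show ?thesis using sin_x_le_x[of "real j * e"] e by (auto simp: S_def divide_le_eq)
  qed (simp add: S_def)
  have S_ge: "1 - R\<^sup>2 * e\<^sup>2 / 2 \<le> S j" if "0 < j" "j \<le> r" for j
  proof -
    have je: "real j * e > 0" using that e by simp
    have "1 - (real j * e)\<^sup>2 / 2 \<le> S j"
      using sin_ge_cubic[of "real j * e"] je unfolding S_def
      by (simp add: pos_le_divide_eq mult.commute)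
    moreover have "(real j * e)\<^sup>2 \<le> (R * e)\<^sup>2"
      using that e R_def by (intro power_mono mult_right_mono) auto
    ultimately show ?thesis by (simp add: power_mult_distrib)
  qed
  define u where "u = R\<^sup>2 * e\<^sup>2 / 2"
  have u: "0 \<le> u" "u \<le> e / 32"
    using mult_right_mono[of "R\<^sup>2 * e" "1 / 16" e] eR2 e unfolding u_def power2_eq_square by auto
  have Su: "1 - u \<le> S j" if "0 < j" "j \<le> r" for j using S_ge[OF that] u_def by simp
  have Spos: "S j > 0" if "0 < j" "j \<le> r" for j using Su[OF that] u e1 by linarith
  have sin_S: "sin (real j * e) = real j * e * S j" if "0 < j" for j
    using that e by (simp add: S_def)
  \<comment> \<open>\<open>\<rho>\<close> is the solution of \<open>eq1\<close>, and
    \<open>z\<close> below then that of \<open>eq2\<close>.\<close>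
  define \<rho> where "\<rho> = (1 + x) * S r / S (r - 1)"
  have r1: "0 < r - 1" "r - 1 \<le> r" "0 < r" using r by auto
  have rr: "real (r - 1) = R - 1" using r by (simp add: R_def)
  have \<rho>0: "\<rho> > 0" unfolding \<rho>_def using x Spos r1 by simp
  have eq1: "(1 - p) * sin (real r * e) = \<rho> * sin (real (r - 1) * e)"
    unfolding q_eq sin_S[OF r1(3)] sin_S[OF r1(1)] \<rho>_def unfolding rr
    using Spos[OF r1(1,2)] R by (simp add: R_def field_simps)
  have sin_pos: "sin e > 0" using e e1 pi_gt3 by (intro sin_gt_zero) auto
  have sin_r: "sin (real r * e) > 0" using sin_S[OF r1(3)] Spos[OF r1(3)] e r1 by simp
  define z where "z = sin e / (p * \<rho> ^ (r - 1) * sin (real r * e))"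
  have z0: "z > 0" unfolding z_def using sin_pos sin_r p0 \<rho>0 by simp
  have eq2: "p * z * \<rho> ^ (r - 1) * sin (real r * e) = sin e"
    unfolding z_def using sin_r p0 \<rho>0 by simp
  have \<rho>_le: "\<rho> \<le> exp (5 * e)"
  proof -
    have "S r / S (r - 1) \<le> 1 / (1 - u)"
      using S_le[of r] Su[OF r1(1,2)] Spos[OF r1(3)] u e1 by (intro frac_le) auto
    also have "\<dots> \<le> 1 + e"
    proof -
      have "e * u \<le> 1 * (e / 32)" using u e e1 by (intro mult_mono) auto
      moreover have "(1 + e) * (1 - u) = 1 + e - u - e * u" by (simp add: algebra_simps)
      ultimately have "(1 + e) * (1 - u) \<ge> 1" using u by linarith
      then show ?thesis using u e1 by (simp add: field_simps)
    qed
    finally have "(1 + x) * (S r / S (r - 1)) \<le> (1 + 4 * e) * (1 + e)"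
      using x e Spos[OF r1(1,2)] Spos[OF r1(3)] by (intro mult_mono) auto
    also have "\<dots> \<le> exp (4 * e) * exp e" using e by (intro mult_mono) auto
    finally show ?thesis unfolding \<rho>_def by (simp flip: exp_add)
  qed
  have C: "\<rho> ^ m \<le> C" if "real m * e \<le> pi" for m
  proof -
    have "\<rho> ^ m \<le> exp (5 * e) ^ m" using \<rho>_le \<rho>0 by (intro power_mono) auto
    also have "\<dots> = exp (5 * (real m * e))" by (simp flip: exp_of_nat_mult add: mult.left_commute)
    also have "\<dots> \<le> C" using that unfolding C_def by simp
    finally show ?thesis .
  qed
  have \<rho>_ge: "(1 + x) * (1 - u) \<le> \<rho>"
  proof -
    have "(1 + x) * S r * 1 \<le> (1 + x) * S r * (1 / S (r - 1))"
      using x Spos[OF r1(3)] r1 S_le Spos[OF r1(1,2)] by (intro mult_left_mono) auto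
    moreover have "(1 + x) * (1 - u) \<le> (1 + x) * S r"
      using x Su[of r] r1 by (intro mult_left_mono) auto
    ultimately show ?thesis unfolding \<rho>_def by simp
  qed
  have m: "real (Suc r) * e \<le> 1 / 16" using eR e e1 unfolding R_def by (simp add: algebra_simps)
  \<comment> \<open>Up to factors \<open>1 - u\<close>, \<open>1 / z\<close> is at least the product
    of \<open>1 - (R - 1) * x\<close> and \<open>1 + (R - 1) * x\<close>, that is
    \<open>1 - (2 * e * R)\<^sup>2\<close>: no term linear in \<open>e\<close> survives.\<close>
  have iz: "1 / z \<ge> 1 - 3 * R ^ 3 * e\<^sup>2"
  proof -
    have "(1 + x) ^ (r - 1) * (1 - u) ^ (r - 1) \<le> \<rho> ^ (r - 1)"
      using \<rho>_ge x u e1 power_mono[OF \<rho>_ge, of "r - 1"] by (simp add: power_mult_distrib)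
    moreover have "1 + (R - 1) * x \<le> (1 + x) ^ (r - 1)"
      using Bernoulli_inequality[of x "r - 1"] x rr by simp
    then have "(1 + (R - 1) * x) * (1 - u) ^ (r - 1) \<le> (1 + x) ^ (r - 1) * (1 - u) ^ (r - 1)"
      using u e1 by (intro mult_right_mono) auto
    ultimately have A: "(1 + (R - 1) * x) * (1 - u) ^ (r - 1) \<le> \<rho> ^ (r - 1)" by linarith
    have "1 - R * u \<le> (1 - u) ^ r"
      using Bernoulli_inequality[of "- u" r] u e1 by (simp add: R_def)
    moreover have "(1 - (2 * e * R)\<^sup>2) * (1 - R * u) \<ge> 1 - (2 * e * R)\<^sup>2 - R * u"
    proof -
      have "0 \<le> (2 * e * R)\<^sup>2 * (R * u)" using R u by simp
      then show ?thesis by (simp add: algebra_simps)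
    qed
    moreover have sq: "(2 * e * R)\<^sup>2 \<le> 1"
      using eR e R by (intro power_le_one) (auto simp: mult.commute[of e R] mult.assoc)
    ultimately have "1 - (2 * e * R)\<^sup>2 - R * u \<le> (1 - (2 * e * R)\<^sup>2) * (1 - u) ^ r"
      using mult_left_mono[of "1 - R * u" "(1 - u) ^ r" "1 - (2 * e * R)\<^sup>2"] by linarith
    moreover have "(2 * e * R)\<^sup>2 + R * u \<le> 3 * R ^ 3 * e\<^sup>2"
    proof -
      have "(2 * e * R)\<^sup>2 + R * u = (4 * R\<^sup>2 + R ^ 3 / 2) * e\<^sup>2"
        unfolding u_def by (simp add: power2_eq_square power3_eq_cube algebra_simps)
      also have "\<dots> \<le> (3 * R ^ 3) * e\<^sup>2" using R23 R3 by (intro mult_right_mono) auto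
      finally show ?thesis .
    qed
    ultimately have B: "1 - 3 * R ^ 3 * e\<^sup>2 \<le> (1 - (2 * e * R)\<^sup>2) * (1 - u) ^ r" by linarith
    have "(1 - (2 * e * R)\<^sup>2) * (1 - u) ^ r
        = (1 - (R - 1) * x) * ((1 + (R - 1) * x) * (1 - u) ^ (r - 1)) * (1 - u)"
      unfolding Rx using r by (cases r) (auto simp: power2_eq_square algebra_simps)
    also have "\<dots> \<le> (1 - (R - 1) * x) * \<rho> ^ (r - 1) * S r"
      using A Su[of r] r1 u e1 \<rho>0 R p0 p_eq
      by (intro mult_mono mult_left_mono mult_nonneg_nonneg) (auto simp: field_simps)
    also have "\<dots> = p * \<rho> ^ (r - 1) * (real r * e * S r) / e"
      unfolding p_eq using e R by (simp add: R_def)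
    also have "\<dots> \<le> p * \<rho> ^ (r - 1) * (real r * e * S r) / sin e"
      using sin_x_le_x[of e] e sin_pos p0 \<rho>0 Spos[OF r1(3)]
      by (intro divide_left_mono mult_nonneg_nonneg mult_pos_pos) auto
    also have "\<dots> = 1 / z" unfolding z_def sin_S[OF r1(3)] by simp
    finally show ?thesis using B by linarith
  qed
  have "exp (- (6 * R ^ 3)) \<le> (1 / z) ^ k"
  proof -
    define y where "y = 3 * R ^ 3 * e\<^sup>2"
    have y: "0 \<le> y" "y \<le> 1 / 2"
      using R mult_mono[of "R ^ 3 * e" "1 / 8" e 1] Re3 e e1
      unfolding y_def power2_eq_square by (auto simp: mult.assoc)
    have "real k * (2 * y) = 6 * R ^ 3 * (real k * e\<^sup>2)" unfolding y_def by simp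
    also have "\<dots> \<le> 6 * R ^ 3 * 1" using k R by (intro mult_left_mono) auto
    finally have "exp (- (6 * R ^ 3)) \<le> exp (- 2 * y) ^ k"
      by (simp flip: exp_of_nat_mult)
    also have "\<dots> \<le> (1 / z) ^ k"
      using exp_le_one_minus[OF y] iz unfolding y_def by (intro power_mono) auto
    finally show ?thesis .
  qed
  moreover have "(1 / 2) ^ Suc r \<le> \<rho> ^ Suc r"
  proof (rule power_mono)
    have "1 * (1 - u) \<le> (1 + x) * (1 - u)" using x u e1 by (intro mult_right_mono) auto
    also note \<rho>_ge
    finally have "1 - u \<le> \<rho>" by simp
    moreover have "1 / 2 \<le> 1 - u" using u e1 by linarith
    ultimately show "1 / 2 \<le> \<rho>" by linarith
  qed simp
  moreover have "e * (1 / 2) \<le> sin (real (Suc r) * e)"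
  proof -
    define y where "y = real (Suc r) * e"
    have y: "e \<le> y" "y \<le> 1 / 16" using m e unfolding y_def by auto
    have "y\<^sup>2 \<le> 1" using y e by (intro power_le_one) auto
    then have "y * (1 / 2) \<le> y * (1 - y\<^sup>2 / 2)" using y e by (intro mult_left_mono) auto
    then show ?thesis using sin_ge_cubic[of y] y e unfolding y_def[symmetric] by linarith
  qed
  ultimately have "(1 / 2) ^ Suc r * (e * (1 / 2)) * exp (- (6 * R ^ 3))
      \<le> \<rho> ^ Suc r * sin (real (Suc r) * e) * (1 / z) ^ k"
    using e \<rho>0 by (intro mult_mono) (auto intro!: mult_nonneg_nonneg order_trans[of 0 "e * (1/2)"])
  also have "\<dots> = \<rho> ^ Suc r * sin (real (Suc r) * e) / z ^ k" by (simp add: power_divide)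
  also have "\<dots> \<le> C * progeny_tail p r k (Suc r)"
    using p0 r e eR \<rho>0 z0 eq1 eq2 C m pi_gt3
    by (intro progeny_tail_ge_sin[where \<theta> = e]) (auto simp: R_def)
  finally have "c * C * e \<le> C * progeny_tail p r k (Suc r)"
    unfolding c_def C_def by (simp add: mult.commute mult.left_commute)
  moreover have "C > 0" by (simp add: C_def)
  ultimately show "c * e \<le> progeny_tail (1 / real r - 2 * e) r k (Suc r)"
    unfolding p_def R_def by (simp add: mult.commute mult.left_commute)
qed

section \<open>Percolation on a fixed regular graph\<close>

lemma percolation_empty: "percolation p {} = return_pmf {}"
  by (simp add: percolation_def)

lemma percolation_insert:
  assumes "finite E" "e \<notin> E"
  shows "percolation p (insert e E) =
    bernoulli_pmf p \<bind> (\<lambda>b. map_pmf (\<lambda>\<omega>. if b then insert e \<omega> else \<omega>) (percolation p E))"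
proof -
  have "{x \<in> insert e E. (f(e := b)) x} = (if b then insert e {x \<in> E. f x} else {x \<in> E. f x})"
    for f :: "'a \<Rightarrow> bool" and b
    using assms(2) by auto
  then show ?thesis
    unfolding percolation_def Pi_pmf_insert'[OF assms]
    by (simp add: map_bind_pmf map_pmf_def[symmetric] pmf.map_comp o_def)
qed

lemma set_percolation: "finite E \<Longrightarrow> set_pmf (percolation p E) \<subseteq> Pow E"
  by (auto simp: percolation_def)

lemma finite_set_percolation: "finite E \<Longrightarrow> finite (set_pmf (percolation p E))"
  by (rule finite_subset[OF set_percolation]) auto

lemma prob_bind_finite:
  fixes M :: "'a pmf" and K :: "'a \<Rightarrow> 'b pmf"
  assumes "finite (set_pmf M)" "\<And>x. x \<in> set_pmf M \<Longrightarrow> finite (set_pmf (K x))"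
  shows "measure_pmf.prob (M \<bind> K) A = (\<Sum>x\<in>set_pmf M. pmf M x * measure_pmf.prob (K x) A)"
proof -
  have "measure_pmf.expectation (M \<bind> K) (indicator A :: 'b \<Rightarrow> real)
      = (\<Sum>x\<in>set_pmf M. pmf M x *\<^sub>R measure_pmf.expectation (K x) (indicator A))"
    using assms by (intro pmf_expectation_bind) auto
  then show ?thesis
    by simp
qed

lemma card_subset_insert_le: "finite B \<Longrightarrow> A \<subseteq> insert w B \<Longrightarrow> card A \<le> Suc (card B)"
  by (metis card_insert_le_m1 card_mono diff_Suc_1 finite.insertI le_trans order_refl zero_less_Suc)

lemma prob_percolation_insert:
  assumes "finite E" "e \<notin> E" "0 \<le> p" "p \<le> 1"
  shows "measure_pmf.prob (percolation p (insert e E)) {\<omega>. Q \<omega>}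
    = p * measure_pmf.prob (percolation p E) {\<omega>. Q (insert e \<omega>)}
      + (1 - p) * measure_pmf.prob (percolation p E) {\<omega>. Q \<omega>}"
proof -
  let ?K = "\<lambda>b. map_pmf (\<lambda>\<omega>. if b then insert e \<omega> else \<omega>) (percolation p E)"
  have "measure_pmf.prob (bernoulli_pmf p \<bind> ?K) {\<omega>. Q \<omega>}
      = (\<Sum>b\<in>UNIV. pmf (bernoulli_pmf p) b * measure_pmf.prob (?K b) {\<omega>. Q \<omega>})"
    using pmf_expectation_bind[of "UNIV :: bool set" ?K "bernoulli_pmf p"
        "indicator {\<omega>. Q \<omega>} :: _ \<Rightarrow> real"] finite_set_percolation[OF assms(1)]
    by simp
  then show ?thesis
    unfolding percolation_insert[OF assms(1,2)] using assms by (simp add: UNIV_bool vimage_def)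
qed

lemma finite_regular_graphs: "finite (regular_graphs d n)"
proof (rule finite_subset)
  show "regular_graphs d n \<subseteq> Pow (Pow {1..n})"
    by (auto simp: regular_graphs_def simple_graph_def)
qed simp

lemma finite_simple_graph: "simple_graph n E \<Longrightarrow> finite E"
  by (rule finite_subset[of _ "Pow {1..n}"]) (auto simp: simple_graph_def)

lemma prob_percolated_regular_graph:
  assumes "regular_graphs d n \<noteq> {}"
  shows "measure_pmf.prob (percolated_regular_graph d n p) A
    = (\<Sum>G\<in>regular_graphs d n. measure_pmf.prob (percolation p G) A) / card (regular_graphs d n)"
proof -
  have "finite (set_pmf (percolation p G))" if "G \<in> regular_graphs d n" for G
    using that by (intro finite_set_percolation finite_simple_graph) (auto simp: regular_graphs_def)
  then show ?thesis
    unfolding percolated_regular_graph_def random_regular_graph_def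
    using assms finite_regular_graphs
    by (subst prob_bind_finite) (auto simp: sum_divide_distrib)
qed

text \<open>The union of the clusters of the vertices of \<open>W\<close>; a set of starting points
  lets the explored part of a cluster be moved into \<open>W\<close> during an induction.\<close>

definition reach :: "'a set set \<Rightarrow> 'a set \<Rightarrow> 'a set" where
  "reach \<omega> W = {(x, y). {x, y} \<in> \<omega>}\<^sup>* `` W"

lemma reach_superset: "W \<subseteq> reach \<omega> W"
  by (auto simp: reach_def)

lemma reach_step: "x \<in> reach \<omega> W \<Longrightarrow> {x, y} \<in> \<omega> \<Longrightarrow> y \<in> reach \<omega> W"
  unfolding reach_def by (auto intro: rtrancl_into_rtrancl)

lemma reach_least:
  assumes "W \<subseteq> Z" "\<And>x y. x \<in> Z \<Longrightarrow> {x, y} \<in> \<omega> \<Longrightarrow> y \<in> Z"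
  shows "reach \<omega> W \<subseteq> Z"
proof
  fix y assume "y \<in> reach \<omega> W"
  then obtain x where x: "x \<in> W" "(x, y) \<in> {(x, y). {x, y} \<in> \<omega>}\<^sup>*" by (auto simp: reach_def)
  from x(2) show "y \<in> Z"
    by (induction rule: rtrancl_induct) (use x(1) assms in auto)
qed

text \<open>A revealed open edge can thus be dropped from the configuration at the price of one more
  starting vertex.\<close>

lemma reach_insert: "u \<in> W \<Longrightarrow> reach (insert {u, w} \<omega>) W \<subseteq> reach \<omega> (insert w W)"
  using reach_superset[of "insert w W" \<omega>]
  by (intro reach_least) (auto simp: doubleton_eq_iff intro: reach_step)

lemma reach_subset: "reach \<omega> W \<subseteq> W \<union> \<Union>\<omega>"
  by (rule reach_least) auto

text \<open>Induction on the number of unrevealed edges, with \<open>W\<close> the explored set and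
  \<open>m\<close> bounding its boundary edges. A closed boundary edge disappears; an open one moves
  its outer end \<open>w\<close> into \<open>W\<close>, which adds at most \<open>r\<close> new
  boundary edges. Collisions only make the boundary smaller.\<close>

lemma prob_reach_le_progeny_tail:
  assumes "finite E" "\<forall>e\<in>E. card e = 2" "0 \<le> p" "p \<le> 1" "finite W"
    and "\<And>v. v \<notin> W \<Longrightarrow> card {e\<in>E. v \<in> e} \<le> Suc r"
    and "card {e\<in>E. e \<inter> W \<noteq> {} \<and> \<not> e \<subseteq> W} \<le> m"
  shows "measure_pmf.prob (percolation p E) {\<omega>. k \<le> card (reach \<omega> W - W)} \<le> progeny_tail p r k m"
  using assms
proof (induction "card E" arbitrary: E W k m)
  case (0 E W k m)
  then have E: "E = {}" by simp
  have "reach {} W \<subseteq> W" by (rule reach_least) auto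
  then have R: "reach {} W - W = {}" by auto
  show ?case
    using progeny_tail_bounds[OF 0(4,5), of r k m]
    by (cases k) (auto simp: E R percolation_empty)
next
  case (Suc c E W k m)
  let ?P = "\<lambda>E Q. measure_pmf.prob (percolation p E) {\<omega>. Q \<omega>}"
  let ?B = "\<lambda>E W. {e\<in>E. e \<inter> W \<noteq> {} \<and> \<not> e \<subseteq> W}"
  note fin = \<open>finite E\<close> \<open>finite W\<close> and p = \<open>0 \<le> p\<close> \<open>p \<le> 1\<close>
  show ?case
  proof (cases "?B E W = {}")
    case True
    have "reach \<omega> W - W = {}" if "\<omega> \<subseteq> E" for \<omega>
    proof -
      have "reach \<omega> W \<subseteq> W" using that True by (intro reach_least) auto
      then show ?thesis by auto
    qed
    note empty = this
    have "set_pmf (percolation p E) \<inter> {\<omega>. Suc k' \<le> card (reach \<omega> W - W)} = {}" for k'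
    proof (rule equals0I)
      fix \<omega> assume "\<omega> \<in> set_pmf (percolation p E) \<inter> {\<omega>. Suc k' \<le> card (reach \<omega> W - W)}"
      then have "\<omega> \<subseteq> E" "Suc k' \<le> card (reach \<omega> W - W)"
        using set_percolation[OF fin(1), of p] by blast+
      then show False using empty[of \<omega>] by (simp only: card.empty)
    qed
    then have "?P E (\<lambda>\<omega>. Suc k' \<le> card (reach \<omega> W - W)) = 0" for k'
      unfolding measure_pmf_zero_iff .
    then show ?thesis
      using progeny_tail_bounds[OF p, of r k m] by (cases k) auto
  next
    case False
    then obtain e where e: "e \<in> E" "e \<inter> W \<noteq> {}" "\<not> e \<subseteq> W" by blast
    obtain u where u: "u \<in> e" "u \<in> W" using e by blast
    obtain w where w: "w \<in> e" "w \<notin> W" using e by blast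
    have "card e = 2" using Suc e by blast
    then have eq: "e = {u, w}" using u w by (metis card_2_iff doubleton_eq_iff insert_iff singletonD)
    define E' where "E' = E - {e}"
    have E: "E = insert e E'" "e \<notin> E'" "finite E'" using e fin by (auto simp: E'_def)
    have c: "c = card E'" using Suc(2) E by auto
    have sub: "card {f\<in>E'. v \<in> f} \<le> card {f\<in>E. v \<in> f}" for v
      using fin by (intro card_mono) (auto simp: E'_def)
    have ins: "?B E W = insert e (?B E' W)" using e by (auto simp: E'_def)
    have "card (?B E W) = Suc (card (?B E' W))"
      unfolding ins using E by (subst card_insert_disjoint) auto
    then obtain m' where m: "m = Suc m'" "card (?B E' W) \<le> m'"
      using Suc(9) by (cases m) auto
    have two: "\<forall>f\<in>E'. card f = 2" using Suc(4) by (simp add: E'_def)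
    have deg: "card {f\<in>E'. v \<in> f} \<le> Suc r" if "v \<notin> W" for v
      using order_trans[OF sub Suc(8)[OF that]] .
    have IH2: "?P E' (\<lambda>\<omega>. k \<le> card (reach \<omega> W - W)) \<le> progeny_tail p r k m'"
      by (rule Suc(1)[OF c E(3) two p fin(2) deg m(2)])
    have "?B E' (insert w W) \<subseteq> ?B E' W \<union> {f\<in>E'. w \<in> f}" by auto
    moreover have "card {f\<in>E'. w \<in> f} \<le> r"
    proof -
      have "{f\<in>E. w \<in> f} = insert e {f\<in>E'. w \<in> f}" using w E(1) by auto
      then have "card {f\<in>E. w \<in> f} = Suc (card {f\<in>E'. w \<in> f})" using E by simp
      then show ?thesis using Suc(8)[OF w(2)] by simp
    qed
    ultimately have "card (?B E' (insert w W)) \<le> m' + r"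
      using m(2) E(3) card_mono[of "?B E' W \<union> {f\<in>E'. w \<in> f}" "?B E' (insert w W)"]
        card_Un_le[of "?B E' W" "{f\<in>E'. w \<in> f}"]
      by simp
    note bound = this
    have IH1: "?P E' (\<lambda>\<omega>. k - 1 \<le> card (reach \<omega> (insert w W) - insert w W))
        \<le> progeny_tail p r (k - 1) (m' + r)"
      by (rule Suc(1)[OF c E(3) two p _ _ bound]) (use fin deg in auto)
    \<comment> \<open>The vertex \<open>w\<close> is itself one of the \<open>k\<close> descendants,
      so \<open>k - 1\<close> remain; for \<open>k = 0\<close> both events are certain.\<close>
    have "?P E' (\<lambda>\<omega>. k \<le> card (reach (insert e \<omega>) W - W))
        \<le> ?P E' (\<lambda>\<omega>. k - 1 \<le> card (reach \<omega> (insert w W) - insert w W))"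
    proof (rule measure_pmf.finite_measure_mono_AE)
      show "AE \<omega> in measure_pmf (percolation p E'). \<omega> \<in> {\<omega>. k \<le> card (reach (insert e \<omega>) W - W)}
          \<longrightarrow> \<omega> \<in> {\<omega>. k - 1 \<le> card (reach \<omega> (insert w W) - insert w W)}"
      proof (rule AE_pmfI, safe)
        fix \<omega> assume \<omega>: "\<omega> \<in> set_pmf (percolation p E')" and k: "k \<le> card (reach (insert e \<omega>) W - W)"
        have "\<omega> \<subseteq> E'" using \<omega> set_percolation[OF E(3), of p] by blast
        moreover have "finite f" if "f \<in> E'" for f using two that by (intro card_ge_0_finite) auto
        ultimately have "finite (\<Union>\<omega>)"
          using E(3) by (intro finite_Union) (auto intro: finite_subset)
        then have fr: "finite (reach \<omega> (insert w W))"
          using reach_subset[of \<omega> "insert w W"] fin by (auto intro: finite_subset)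
        have "reach (insert e \<omega>) W - W \<subseteq> insert w (reach \<omega> (insert w W) - insert w W)"
          using reach_insert[OF u(2), of w \<omega>] eq by auto
        then have "card (reach (insert e \<omega>) W - W) \<le> Suc (card (reach \<omega> (insert w W) - insert w W))"
          using fr by (intro card_subset_insert_le) auto
        then show "k - 1 \<le> card (reach \<omega> (insert w W) - insert w W)" using k by simp
      qed
    qed simp
    then have "?P E (\<lambda>\<omega>. k \<le> card (reach \<omega> W - W))
        \<le> p * progeny_tail p r (k - 1) (m' + r) + (1 - p) * progeny_tail p r k m'"
      unfolding E(1) prob_percolation_insert[OF E(3,2) p]
      using IH1 IH2 p by (intro add_mono mult_left_mono) auto
    then show ?thesis unfolding m(1) progeny_tail_rec .
  qed
qed

text \<open>The root has \<open>Suc r\<close> half-edges but is not among its own descendants, hence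
  \<open>Suc k\<close> on the left and \<open>k\<close> on the right.\<close>

lemma prob_component_le:
  assumes "G \<in> regular_graphs (Suc r) n" "0 \<le> p" "p \<le> 1"
  shows "measure_pmf.prob (percolation p G) {H. Suc k \<le> card (connected_rel n H `` {v})}
    \<le> progeny_tail p r k (Suc r)"
proof (cases "v \<in> {1..n}")
  case False
  then have "connected_rel n H `` {v} = {}" for H by (auto simp: connected_rel_def)
  then show ?thesis using progeny_tail_bounds[OF assms(2,3)] by simp
next
  case True
  have G: "finite G" "\<forall>e\<in>G. card e = 2" "\<forall>e\<in>G. e \<subseteq> {1..n}" and deg: "\<forall>v\<in>{1..n}. card {e\<in>G. v \<in> e} = Suc r"
    using assms(1) finite_simple_graph by (auto simp: regular_graphs_def simple_graph_def degree_def)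
  have deg': "card {e\<in>G. w \<in> e} \<le> Suc r" for w
  proof (cases "w \<in> {1..n}")
    case False
    then have "{e\<in>G. w \<in> e} = {}" using G(3) by blast
    then have "card {e\<in>G. w \<in> e} = 0" by (simp only: card.empty)
    then show ?thesis by linarith
  qed (use deg in auto)
  have "measure_pmf.prob (percolation p G) {H. Suc k \<le> card (connected_rel n H `` {v})}
    \<le> measure_pmf.prob (percolation p G) {H. k \<le> card (reach H {v} - {v})}"
  proof (rule measure_pmf.finite_measure_mono_AE)
    show "AE H in measure_pmf (percolation p G). H \<in> {H. Suc k \<le> card (connected_rel n H `` {v})}
        \<longrightarrow> H \<in> {H. k \<le> card (reach H {v} - {v})}"
    proof (rule AE_pmfI, safe)
      fix H assume H: "H \<in> set_pmf (percolation p G)" and k: "Suc k \<le> card (connected_rel n H `` {v})"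
      have "finite (\<Union>H)"
        using H set_percolation[OF G(1), of p] G(3) by (intro finite_subset[of "\<Union>H" "{1..n}"]) auto
      then have "finite (reach H {v})"
        using reach_subset[of H "{v}"] by (auto intro: finite_subset)
      moreover have "connected_rel n H `` {v} \<subseteq> insert v (reach H {v} - {v})"
        by (auto simp: connected_rel_def reach_def)
      ultimately have "card (connected_rel n H `` {v}) \<le> Suc (card (reach H {v} - {v}))"
        by (intro card_subset_insert_le) auto
      then show "k \<le> card (reach H {v} - {v})" using k by simp
    qed
  qed simp
  also have "\<dots> \<le> progeny_tail p r k (Suc r)"
  proof (rule prob_reach_le_progeny_tail[OF G(1,2) assms(2,3)])
    have "card {e\<in>G. e \<inter> {v} \<noteq> {} \<and> \<not> e \<subseteq> {v}} \<le> card {e\<in>G. v \<in> e}"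
      using G(1) by (intro card_mono) auto
    then show "card {e\<in>G. e \<inter> {v} \<noteq> {} \<and> \<not> e \<subseteq> {v}} \<le> Suc r" using deg'[of v] by linarith
  qed (use deg' in auto)
  finally show ?thesis .
qed

section \<open>Components and the number of vertices in large ones\<close>

lemma connected_rel_equiv: "equiv {1..n} (connected_rel n H)"
proof (rule equivI)
  have "sym {(x, y). {x, y} \<in> H}" by (auto simp: sym_def insert_commute)
  then have "sym ({(x, y). {x, y} \<in> H}\<^sup>*)" by (rule sym_rtrancl)
  then show "sym (connected_rel n H)" by (auto simp: connected_rel_def sym_def)
qed (auto simp: connected_rel_def refl_on_def trans_def)

lemma components_eq: "components n H = (\<lambda>v. connected_rel n H `` {v}) ` {1..n}"
  by (auto simp: components_def quotient_def)

lemma largest_component_ge_iff: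
  assumes "n > 0"
  shows "k \<le> largest_component n H \<longleftrightarrow> (\<exists>v\<in>{1..n}. k \<le> card (connected_rel n H `` {v}))"
proof -
  have ne: "finite (card ` components n H)" "card ` components n H \<noteq> {}"
    using assms unfolding components_eq by auto
  then show ?thesis
    unfolding largest_component_def Max_ge_iff[OF ne] by (simp add: components_eq)
qed

text \<open>All vertices of a component share it, so one large component yields as many vertices
  with large components.\<close>

lemma largest_component_card_large:
  assumes "n > 0" "k \<le> largest_component n H"
  shows "k \<le> card {v\<in>{1..n}. k \<le> card (connected_rel n H `` {v})}"
proof -
  obtain v where v: "v \<in> {1..n}" "k \<le> card (connected_rel n H `` {v})"
    using assms largest_component_ge_iff by blast
  have "connected_rel n H `` {v} \<subseteq> {v\<in>{1..n}. k \<le> card (connected_rel n H `` {v})}"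
  proof
    fix w assume w: "w \<in> connected_rel n H `` {v}"
    then have "connected_rel n H `` {v} = connected_rel n H `` {w}"
      using equiv_class_eq[OF connected_rel_equiv] by auto
    moreover have "w \<in> {1..n}" using w by (auto simp: connected_rel_def)
    ultimately show "w \<in> {v\<in>{1..n}. k \<le> card (connected_rel n H `` {v})}" using v by simp
  qed
  then have "card (connected_rel n H `` {v}) \<le> card {v\<in>{1..n}. k \<le> card (connected_rel n H `` {v})}"
    by (intro card_mono) auto
  then show ?thesis using v by simp
qed

text \<open>Markov's inequality for the number of vertices whose component has at least
  \<open>Suc k\<close> elements.\<close>

lemma prob_largest_component_le:
  assumes "G \<in> regular_graphs (Suc r) n" "0 \<le> p" "p \<le> 1" "n > 0"
  shows "real (Suc k) * measure_pmf.prob (percolation p G) {H. Suc k \<le> largest_component n H}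
    \<le> real n * progeny_tail p r k (Suc r)"
proof -
  let ?M = "percolation p G"
  let ?A = "{H. Suc k \<le> largest_component n H}"
  let ?B = "\<lambda>v. {H. Suc k \<le> card (connected_rel n H `` {v})}"
  have fin: "finite (set_pmf ?M)"
    using assms finite_simple_graph by (intro finite_set_percolation) (auto simp: regular_graphs_def)
  have "real (Suc k) * measure_pmf.prob ?M ?A = measure_pmf.expectation ?M (\<lambda>H. real (Suc k) * indicator ?A H)"
    by simp
  also have "\<dots> \<le> measure_pmf.expectation ?M (\<lambda>H. \<Sum>v\<in>{1..n}. indicator (?B v) H)"
  proof (rule integral_mono)
    fix H
    have "real (Suc k) * indicator ?A H \<le> real (card {v\<in>{1..n}. H \<in> ?B v})"
      using largest_component_card_large[OF assms(4), of "Suc k" H]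
      by (auto simp: indicator_def simp del: of_nat_Suc)
    also have "\<dots> = (\<Sum>v\<in>{1..n}. indicator (?B v) H)"
      by (simp add: indicator_def sum.If_cases Int_def)
    finally show "real (Suc k) * indicator ?A H \<le> (\<Sum>v\<in>{1..n}. indicator (?B v) H)" .
  qed (auto intro!: integrable_measure_pmf_finite fin)
  also have "\<dots> = (\<Sum>v\<in>{1..n}. measure_pmf.prob ?M (?B v))"
    by (subst Bochner_Integration.integral_sum) (auto intro!: integrable_measure_pmf_finite fin)
  also have "\<dots> \<le> (\<Sum>v\<in>{1..n}. progeny_tail p r k (Suc r))"
    using assms by (intro sum_mono prob_component_le) auto
  finally show ?thesis by simp
qed

section \<open>Switchings in random regular graphs\<close>

lemma doubleton_left_inj: "inj_on (\<lambda>w. {u, w}) A"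
  by (auto simp: inj_on_def doubleton_eq_iff)

lemma simple_graph_edgeD:
  assumes "simple_graph n G" "{x, y} \<in> G"
  shows "x \<noteq> y" "x \<in> {1..n}" "y \<in> {1..n}"
proof -
  have *: "{x, y} \<subseteq> {1..n}" "card {x, y} = 2" using assms unfolding simple_graph_def by blast+
  show "x \<noteq> y" using *(2) by (cases "x = y") auto
  show "x \<in> {1..n}" "y \<in> {1..n}" using *(1) by auto
qed

lemma edges_at_eq_image:
  assumes "simple_graph n G"
  shows "{e\<in>G. u \<in> e} = (\<lambda>x. {u, x}) ` {x. {u, x} \<in> G}"
proof (intro equalityI subsetI)
  fix e assume e: "e \<in> {e\<in>G. u \<in> e}"
  then have "card e = 2" using assms by (auto simp: simple_graph_def)
  then obtain x where "e = {u, x}"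
    using e by (metis (no_types, lifting) card_2_iff doubleton_eq_iff insertE mem_Collect_eq singletonD)
  then show "e \<in> (\<lambda>x. {u, x}) ` {x. {u, x} \<in> G}" using e by auto
qed auto

lemma card_neighbours: "simple_graph n G \<Longrightarrow> card {x. {u, x} \<in> G} = degree G u"
  unfolding degree_def edges_at_eq_image by (rule card_image[OF doubleton_left_inj, symmetric])

lemma neighbours_subset: "simple_graph n G \<Longrightarrow> {x. {u, x} \<in> G} \<subseteq> {1..n}"
  using simple_graph_edgeD(3) by blast

lemma degree_insert:
  assumes "finite E" "e \<notin> E"
  shows "degree (insert e E) v = degree E v + of_bool (v \<in> e)"
proof (cases "v \<in> e")
  case True
  then have "{f \<in> insert e E. v \<in> f} = insert e {f\<in>E. v \<in> f}" by auto
  then show ?thesis using assms True by (simp add: degree_def)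
next
  case False
  then have "{f \<in> insert e E. v \<in> f} = {f\<in>E. v \<in> f}" by auto
  then show ?thesis using False by (simp add: degree_def)
qed

text \<open>The graphs compatible with the revealed edges \<open>R\<close>. Only edges that are
  present are ever revealed, so counting in this set replaces conditioning.\<close>

definition extensions :: "nat \<Rightarrow> nat \<Rightarrow> nat set set \<Rightarrow> nat set set set" where
  "extensions d n R = {G \<in> regular_graphs d n. R \<subseteq> G}"

lemma finite_extensions: "finite (extensions d n R)"
  unfolding extensions_def using finite_regular_graphs by auto

lemma extensionsD:
  assumes "G \<in> extensions d n R"
  shows "simple_graph n G" "R \<subseteq> G" "finite G" "\<And>v. v \<in> {1..n} \<Longrightarrow> degree G v = d"
proof -
  have *: "simple_graph n G" "R \<subseteq> G" "\<forall>v\<in>{1..n}. degree G v = d"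
    using assms by (simp_all add: extensions_def regular_graphs_def)
  then show "simple_graph n G" "R \<subseteq> G" "finite G" "\<And>v. v \<in> {1..n} \<Longrightarrow> degree G v = d"
    using finite_simple_graph[OF *(1)] by blast+
qed

text \<open>A uniformly random unrevealed neighbour \<open>w\<close> of \<open>u\<close> leaves \<open>G\<close> uniform among the
  graphs that extend \<open>insert {u, w} R\<close>: every graph extending \<open>R\<close> has the same number
  \<open>d - degree R u\<close> of choices for \<open>w\<close>.\<close>

lemma sum_extensions_reveal:
  fixes f :: "nat set set \<Rightarrow> real"
  assumes u: "u \<in> {1..n}"
  shows "(\<Sum>w | w \<in> {1..n} \<and> {u, w} \<notin> R \<and> w \<noteq> u. \<Sum>G\<in>extensions d n (insert {u, w} R). f G)
    = real (d - degree R u) * (\<Sum>G\<in>extensions d n R. f G)"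
proof -
  let ?A = "{w. w \<in> {1..n} \<and> {u, w} \<notin> R \<and> w \<noteq> u}"
  have count: "card {w\<in>?A. {u, w} \<in> G} = d - degree R u" if G: "G \<in> extensions d n R" for G
  proof -
    note * = extensionsD[OF G]
    have "(\<lambda>w. {u, w}) ` {w\<in>?A. {u, w} \<in> G} = {e\<in>G. u \<in> e} - {e\<in>R. u \<in> e}"
      unfolding edges_at_eq_image[OF *(1)] using simple_graph_edgeD[OF *(1)] by blast
    note image = this
    have "card {w\<in>?A. {u, w} \<in> G} = card ((\<lambda>w. {u, w}) ` {w\<in>?A. {u, w} \<in> G})"
      by (rule card_image[OF doubleton_left_inj, symmetric])
    also have "\<dots> = card ({e\<in>G. u \<in> e} - {e\<in>R. u \<in> e})" by (rule arg_cong[OF image])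
    also have "\<dots> = degree G u - degree R u"
      unfolding degree_def using *(2) finite_subset[OF *(2,3)] by (intro card_Diff_subset) auto
    finally show ?thesis using *(4)[OF u] by simp
  qed
  have "(\<Sum>w\<in>?A. \<Sum>G\<in>extensions d n (insert {u, w} R). f G)
      = (\<Sum>w\<in>?A. \<Sum>G\<in>extensions d n R. if {u, w} \<in> G then f G else 0)"
  proof (rule sum.cong[OF refl])
    fix w
    have "extensions d n (insert {u, w} R) = {G \<in> extensions d n R. {u, w} \<in> G}"
      by (auto simp: extensions_def)
    then show "(\<Sum>G\<in>extensions d n (insert {u, w} R). f G)
        = (\<Sum>G\<in>extensions d n R. if {u, w} \<in> G then f G else 0)"
      by (simp only: sum.inter_filter[OF finite_extensions])
  qed
  also have "\<dots> = (\<Sum>G\<in>extensions d n R. \<Sum>w\<in>?A. if {u, w} \<in> G then f G else 0)"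
    by (rule sum.swap)
  also have "\<dots> = (\<Sum>G\<in>extensions d n R. real (d - degree R u) * f G)"
  proof (rule sum.cong[OF refl])
    fix G assume G: "G \<in> extensions d n R"
    have "(\<Sum>w\<in>?A. if {u, w} \<in> G then f G else 0) = (\<Sum>w\<in>{w\<in>?A. {u, w} \<in> G}. f G)"
      by (rule sum.inter_filter[symmetric]) simp
    then show "(\<Sum>w\<in>?A. if {u, w} \<in> G then f G else 0) = real (d - degree R u) * f G"
      using count[OF G] by simp
  qed
  finally show ?thesis by (simp add: sum_distrib_left)
qed

text \<open>The switching replaces the edges \<open>{u, w}\<close>, \<open>{x, y}\<close> by \<open>{u, x}\<close>, \<open>{w, y}\<close>.\<close>

lemma card_extensions_insert_le:
  assumes uw: "u \<in> {1..n}" "w \<in> {1..n}" "u \<noteq> w" "{u, w} \<notin> R" and fin: "finite R"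
    and big: "n + 2 * card R + 2 * (d * Suc d) \<le> n * d"
  shows "n * card (extensions d n (insert {u, w} R)) \<le> d * d * card (extensions d n R)"
proof -
  let ?X = "extensions d n (insert {u, w} R)" and ?Y = "extensions d n R"
  let ?N = "\<lambda>G v. {x. {v, x} \<in> G}"
  \<comment> \<open>The oriented edges that can be switched with \<open>{u, w}\<close>. The three
    sets removed are the revealed edges and the edges that start in the closed neighbourhood of
    \<open>u\<close> or end in that of \<open>w\<close>; by \<open>big\<close> at least
    \<open>n\<close> remain.\<close>
  define P where "P = (\<lambda>G. (SIGMA x:{1..n}. ?N G x)
    - ({(x, y). {x, y} \<in> R} \<union> (SIGMA x:insert u (?N G u). ?N G x)
        \<union> (\<lambda>(y, x). (x, y)) ` (SIGMA y:insert w (?N G w). ?N G y)))"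
  have PD: "{x, y} \<in> G" "{x, y} \<notin> R" "x \<noteq> u" "{u, x} \<notin> G" "y \<noteq> w" "{w, y} \<notin> G"
    "x \<in> {1..n}" "y \<in> {1..n}" "x \<noteq> y" "x \<noteq> w" "y \<noteq> u"
    if "(x, y) \<in> P G" "G \<in> ?X" for x y G
  proof -
    note * = extensionsD[OF that(2)]
    have xy: "{x, y} \<in> G" using that by (auto simp: P_def)
    then have yx: "{y, x} \<in> G" by (simp add: insert_commute)
    show "{x, y} \<in> G" "{x, y} \<notin> R" "x \<noteq> u" "{u, x} \<notin> G" using that xy by (auto simp: P_def)
    show yw: "y \<noteq> w" "{w, y} \<notin> G" using that xy yx unfolding P_def by (auto simp: image_iff)
    show "x \<in> {1..n}" "y \<in> {1..n}" "x \<noteq> y" using simple_graph_edgeD[OF *(1) xy] by auto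
    show "x \<noteq> w" using \<open>{u, x} \<notin> G\<close> *(2) by auto
    show "y \<noteq> u" using yw *(2) by (auto simp: insert_commute)
  qed
  have P_card: "n \<le> card (P G) \<and> finite (P G)" if G: "G \<in> ?X" for G
  proof -
    note * = extensionsD[OF G]
    have N: "finite (?N G v)" "v \<in> {1..n} \<Longrightarrow> card (?N G v) = d" for v
      using neighbours_subset[OF *(1), of v] card_neighbours[OF *(1), of v] *(4)[of v]
      by (auto intro: finite_subset)
    have S: "card (SIGMA x:insert v (?N G v). ?N G x) \<le> d * Suc d" if "v \<in> {1..n}" for v
    proof -
      have "card (SIGMA x:insert v (?N G v). ?N G x) = (\<Sum>x\<in>insert v (?N G v). card (?N G x))"
        using N by (intro card_SigmaI) auto
      also have "\<dots> = (\<Sum>x\<in>insert v (?N G v). d)"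
        using N(2) neighbours_subset[OF *(1), of v] that by (intro sum.cong) auto
      also have "\<dots> \<le> d * Suc d"
        using N(1)[of v] N(2)[OF that] by (simp add: card_insert_if)
      finally show ?thesis .
    qed
    have all: "card (SIGMA x:{1..n}. ?N G x) = n * d"
      using N by (subst card_SigmaI) auto
    have R: "card {(x, y). {x, y} \<in> R} \<le> 2 * card R" "finite {(x, y). {x, y} \<in> R}"
    proof -
      \<comment> \<open>The second component distinguishes the two orientations of an edge.\<close>
      let ?g = "\<lambda>(x, y). ({x, y}, x < (y::nat))"
      have inj: "inj_on ?g {(x, y). {x, y} \<in> R}"
        by (auto simp: inj_on_def doubleton_eq_iff)
      have sub: "?g ` {(x, y). {x, y} \<in> R} \<subseteq> R \<times> UNIV" by auto
      show "finite {(x, y). {x, y} \<in> R}"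
        using inj_on_finite[OF inj sub] fin by simp
      show "card {(x, y). {x, y} \<in> R} \<le> 2 * card R"
        using card_inj_on_le[OF inj sub] fin by (simp add: card_cartesian_product)
    qed
    let ?B1 = "{(x, y). {x, y} \<in> R}" and ?B2 = "SIGMA x:insert u (?N G u). ?N G x"
    let ?B3 = "(\<lambda>(y, x). (x, y)) ` (SIGMA y:insert w (?N G w). ?N G y)"
    have f3: "finite (SIGMA y:insert w (?N G w). ?N G y)" "finite ?B2" using N by auto
    have "card (?B1 \<union> ?B2 \<union> ?B3) \<le> card ?B1 + card ?B2 + card ?B3"
      by (meson add_le_mono card_Un_le le_refl le_trans)
    also have "\<dots> \<le> 2 * card R + d * Suc d + d * Suc d"
      using R(1) S[OF uw(1)] S[OF uw(2)] card_image_le[OF f3(1), of "\<lambda>(y, x). (x, y)"] by linarith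
    finally have B: "card (?B1 \<union> ?B2 \<union> ?B3) \<le> 2 * card R + d * Suc d + d * Suc d" .
    have fB: "finite (?B1 \<union> ?B2 \<union> ?B3)" using R(2) f3 by auto
    have "n * d - card (?B1 \<union> ?B2 \<union> ?B3) \<le> card (P G)"
      unfolding P_def all[symmetric] by (rule diff_card_le_card_Diff[OF fB])
    moreover have "finite (P G)" unfolding P_def using N by (intro finite_Diff finite_SigmaI) auto
    ultimately show ?thesis using B big by linarith
  qed
  define sw where "sw = (\<lambda>G x y. insert {u, x} (insert {w, y} (G - {{u, w}, {x, y}})))"
  have sw: "sw G x y \<in> ?Y" "{u, x} \<in> sw G x y" "{w, y} \<in> sw G x y"
    "G = insert {u, w} (insert {x, y} (sw G x y - {{u, x}, {w, y}}))"
    if G: "G \<in> ?X" and xy: "(x, y) \<in> P G" for G x y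
  proof -
    note * = extensionsD[OF G] and ** = PD[OF xy G]
    define H where "H = G - {{u, w}, {x, y}}"
    have fH: "finite H" using * by (simp add: H_def)
    have GH: "G = insert {u, w} (insert {x, y} H)" using * ** by (auto simp: H_def)
    have swH: "sw G x y = insert {u, x} (insert {w, y} H)" by (simp add: sw_def H_def)
    have ne: "{u, w} \<noteq> {x, y}" "{u, x} \<noteq> {w, y}"
      using **(3,5,10,11) uw(3) by (simp_all add: doubleton_eq_iff)
    have nin: "{u, w} \<notin> insert {x, y} H" "{x, y} \<notin> H" "{u, x} \<notin> insert {w, y} H" "{w, y} \<notin> H"
      using ne **(4,6) by (simp_all add: H_def)
    have sg: "simple_graph n (sw G x y)"
      using *(1) **(3,5,7,8) uw(1,2) unfolding swH simple_graph_def H_def by simp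
    have "degree (sw G x y) v = degree G v" for v
    proof -
      have "degree (sw G x y) v = degree H v + of_bool (v \<in> {w, y}) + of_bool (v \<in> {u, x})"
        unfolding swH using degree_insert[OF finite.insertI[OF fH] nin(3), of v]
          degree_insert[OF fH nin(4), of v] by linarith
      moreover have "degree G v = degree H v + of_bool (v \<in> {x, y}) + of_bool (v \<in> {u, w})"
        using arg_cong[OF GH, of "\<lambda>E. degree E v"]
          degree_insert[OF finite.insertI[OF fH] nin(1), of v] degree_insert[OF fH nin(2), of v]
        by linarith
      ultimately show ?thesis using **(3,5,9-11) uw(3) by auto
    qed
    moreover have "R \<subseteq> sw G x y" using *(2) **(2) uw(4) by (auto simp: sw_def)
    ultimately show "sw G x y \<in> ?Y"
      using sg *(4) by (simp add: extensions_def regular_graphs_def)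
    show "{u, x} \<in> sw G x y" "{w, y} \<in> sw G x y" by (auto simp: sw_def)
    have "sw G x y - {{u, x}, {w, y}} = H" unfolding swH using nin by auto
    then show "G = insert {u, w} (insert {x, y} (sw G x y - {{u, x}, {w, y}}))" using GH by simp
  qed
  \<comment> \<open>Given \<open>x\<close> and \<open>y\<close>, the switching can be undone. In the
    new graph \<open>x\<close> is a neighbour of \<open>u\<close> and \<open>y\<close> one of
    \<open>w\<close>, so each graph of \<open>?Y\<close> arises from at most \<open>d * d\<close>
    triples.\<close>
  let ?S = "SIGMA G:?X. P G" and ?T = "SIGMA G:?Y. ?N G u \<times> ?N G w"
  let ?h = "\<lambda>(G, x, y). (sw G x y, x, y)"
  have NY: "finite (?N G v)" "v \<in> {1..n} \<Longrightarrow> card (?N G v) = d" if G: "G \<in> ?Y" for G v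
    using finite_subset[OF neighbours_subset[OF extensionsD(1)[OF G]], of v]
      card_neighbours[OF extensionsD(1)[OF G], of v] extensionsD(4)[OF G, of v] by simp_all
  have "n * card ?X = (\<Sum>G\<in>?X. n)" by simp
  also have "\<dots> \<le> (\<Sum>G\<in>?X. card (P G))" using P_card by (intro sum_mono) blast
  also have "\<dots> = card ?S"
    using finite_extensions P_card by (intro card_SigmaI[symmetric]) auto
  also have "\<dots> \<le> card ?T"
  proof (rule card_inj_on_le)
    show "inj_on ?h ?S"
    proof (rule inj_onI)
      fix a b assume ab: "a \<in> ?S" "b \<in> ?S" "?h a = ?h b"
      obtain G x y where a: "a = (G, x, y)" by (cases a)
      obtain G' x' y' where b: "b = (G', x', y')" by (cases b)
      have A: "G \<in> ?X" "(x, y) \<in> P G" "G' \<in> ?X" "(x, y) \<in> P G'" "sw G x y = sw G' x y"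
        "x' = x" "y' = y"
        using ab unfolding a b by auto
      then show "a = b" unfolding a b using sw(4)[OF A(1,2)] sw(4)[OF A(3,4)] by simp
    qed
    show "?h ` ?S \<subseteq> ?T" using sw(1-3) by auto
    show "finite ?T"
      using finite_extensions NY(1) by (intro finite_SigmaI finite_cartesian_product) simp_all
  qed
  also have "\<dots> = (\<Sum>G\<in>?Y. card (?N G u \<times> ?N G w))"
    using finite_extensions NY(1) by (intro card_SigmaI) simp_all
  also have "\<dots> = (\<Sum>G\<in>?Y. d * d)"
    using NY(2) uw(1,2) by (intro sum.cong) (simp_all add: card_cartesian_product)
  finally show ?thesis by (simp add: mult.commute)
qed

section \<open>Joint exploration of the graph and the percolation\<close>

lemma edge_rtrancl_mono:
  "\<omega> \<subseteq> \<omega>' \<Longrightarrow> {(x, y). {x, y} \<in> \<omega>}\<^sup>* \<subseteq> {(x, y). {x, y} \<in> \<omega>'}\<^sup>*"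
  by (rule rtrancl_mono) blast

lemma reach_mono: "\<omega> \<subseteq> \<omega>' \<Longrightarrow> reach \<omega> W \<subseteq> reach \<omega>' W"
  unfolding reach_def by (rule Image_mono[OF edge_rtrancl_mono order_refl])

lemma connected_rel_mono:
  assumes "H \<subseteq> H'"
  shows "connected_rel n H \<subseteq> connected_rel n H'"
proof (rule subrelI)
  fix x y assume "(x, y) \<in> connected_rel n H"
  then have "x \<in> {1..n}" "y \<in> {1..n}" "(x, y) \<in> {(x, y). {x, y} \<in> H}\<^sup>*"
    unfolding connected_rel_def by blast+
  then show "(x, y) \<in> connected_rel n H'"
    using subsetD[OF edge_rtrancl_mono[OF assms]] unfolding connected_rel_def by blast
qed

lemma finite_component: "finite (connected_rel n H `` {v})"
  by (rule finite_subset[of _ "{1..n}"]) (auto simp: connected_rel_def)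

lemma largest_component_mono:
  assumes "n > 0" "H \<subseteq> H'"
  shows "largest_component n H \<le> largest_component n H'"
proof -
  obtain v where v: "v \<in> {1..n}" "largest_component n H \<le> card (connected_rel n H `` {v})"
    using largest_component_ge_iff[OF assms(1), THEN iffD1, OF order_refl] by blast
  have "card (connected_rel n H `` {v}) \<le> card (connected_rel n H' `` {v})"
    by (rule card_mono[OF finite_component Image_mono[OF connected_rel_mono[OF assms(2)] order_refl]])
  with v(2) have "largest_component n H \<le> card (connected_rel n H' `` {v})" by (rule order_trans)
  then show ?thesis by (rule largest_component_ge_iff[OF assms(1), THEN iffD2, OF bexI[OF _ v(1)]])
qed

lemma card_le_largest_component:
  assumes "v \<in> W" "W \<subseteq> reach H {v}" "W \<subseteq> {1..n}"
  shows "card W \<le> largest_component n H"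
proof -
  have v: "v \<in> {1..n}" using assms(1,3) by blast
  then have n: "n > 0" by simp
  have "W \<subseteq> connected_rel n H `` {v}"
  proof
    fix x assume x: "x \<in> W"
    have "x \<in> reach H {v}" "x \<in> {1..n}" using subsetD[OF assms(2) x] subsetD[OF assms(3) x] .
    then show "x \<in> connected_rel n H `` {v}" using v by (simp add: connected_rel_def reach_def)
  qed
  then have "card W \<le> card (connected_rel n H `` {v})" by (intro card_mono finite_component)
  then show ?thesis by (rule largest_component_ge_iff[OF n, THEN iffD2, OF bexI[OF _ v]])
qed

text \<open>In the exploration \<open>R\<close> holds the revealed edges and \<open>Op\<close> the
  open ones among them; for a fixed graph \<open>G\<close> only the edges of \<open>G - R\<close>
  are still random.\<close>

definition miss_prob :: "real \<Rightarrow> nat \<Rightarrow> nat \<Rightarrow> nat set set \<Rightarrow> nat set set \<Rightarrow> nat set set \<Rightarrow> real" where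
  "miss_prob p n A Op R G =
     measure_pmf.prob (percolation p (G - R)) {\<omega>. largest_component n (Op \<union> \<omega>) < A}"

lemma miss_prob_le_1: "miss_prob p n A Op R G \<le> 1"
  by (simp add: miss_prob_def)

lemma miss_prob_anti:
  assumes "n > 0" "Op \<subseteq> Op'"
  shows "miss_prob p n A Op' R G \<le> miss_prob p n A Op R G"
  unfolding miss_prob_def
proof (rule measure_pmf.finite_measure_mono)
  show "{\<omega>. largest_component n (Op' \<union> \<omega>) < A} \<subseteq> {\<omega>. largest_component n (Op \<union> \<omega>) < A}"
  proof
    fix \<omega> assume "\<omega> \<in> {\<omega>. largest_component n (Op' \<union> \<omega>) < A}"
    moreover have "largest_component n (Op \<union> \<omega>) \<le> largest_component n (Op' \<union> \<omega>)"
      using assms by (intro largest_component_mono) auto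
    ultimately show "\<omega> \<in> {\<omega>. largest_component n (Op \<union> \<omega>) < A}" by simp
  qed
qed simp

lemma miss_prob_reveal:
  assumes "finite G" "e \<in> G" "e \<notin> R" "0 \<le> p" "p \<le> 1"
  shows "miss_prob p n A Op R G
    = p * miss_prob p n A (insert e Op) (insert e R) G + (1 - p) * miss_prob p n A Op (insert e R) G"
proof -
  have *: "G - R = insert e (G - insert e R)" using assms(2,3) by blast
  have "finite (G - insert e R)" "e \<notin> G - insert e R" using assms(1) by simp_all
  from prob_percolation_insert[OF this assms(4,5), of "\<lambda>\<omega>. largest_component n (Op \<union> \<omega>) < A"]
  show ?thesis unfolding miss_prob_def * by (simp only: Un_insert_left Un_insert_right)
qed

lemma miss_prob_eq_0:
  assumes "v \<in> W" "W \<subseteq> reach Op {v}" "W \<subseteq> {1..n}" "A \<le> card W"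
  shows "miss_prob p n A Op R G = 0"
proof -
  have "A \<le> largest_component n (Op \<union> \<omega>)" for \<omega>
  proof -
    have "W \<subseteq> reach (Op \<union> \<omega>) {v}"
      using assms(2) reach_mono[of Op "Op \<union> \<omega>" "{v}"] by blast
    from card_le_largest_component[OF assms(1) this assms(3)] show ?thesis using assms(4) by simp
  qed
  then have "{\<omega>. largest_component n (Op \<union> \<omega>) < A} = {}" by (auto simp: not_less)
  then show ?thesis unfolding miss_prob_def by (simp only: measure_empty)
qed

text \<open>Here \<open>a\<close>, \<open>b\<close>, \<open>c\<close> are the tails after a success, a failure and a collision. The
  recursion at parameter \<open>p'\<close> gives \<open>b - c \<le> a - b\<close>, so that collisions of total weight
  \<open>\<eta>\<close> are paid for by lowering \<open>p\<close> to \<open>p' \<le> p - 2 * \<eta>\<close>.\<close>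

lemma progeny_tail_collision:
  assumes p': "0 \<le> p'" "p' \<le> 1 / 2" and k: "k > 0"
    and a: "a = progeny_tail p' r (k - 1) (m + r)" and b: "b = progeny_tail p' r k m"
    and c: "c = progeny_tail p' r k (m - 1)"
  shows "b \<le> a" "c \<le> b" "b - c \<le> a - b"
proof -
  have p1: "p' \<le> 1" using p' by simp
  note mono = progeny_tail_mono[OF p'(1) p1]
  have "b \<le> progeny_tail p' r k (m + r)" unfolding b by (rule mono) simp
  moreover obtain k' where "k = Suc k'" using k by (cases k) auto
  then have "progeny_tail p' r k (m + r) \<le> a"
    unfolding a using progeny_tail_Suc_left[OF p'(1) p1, of r k' "m + r"] by simp
  ultimately show ba: "b \<le> a" by linarith
  show cb: "c \<le> b" unfolding b c by (rule mono) simp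
  show "b - c \<le> a - b"
  proof (cases m)
    case 0
    then have "b = c" using b c by simp
    then show ?thesis using ba by linarith
  next
    case (Suc m')
    have "progeny_tail p' r (k - 1) (m' + r) \<le> a" unfolding a Suc by (rule mono) simp
    from mult_left_mono[OF this p'(1)]
    have "b \<le> p' * a + (1 - p') * c"
      using progeny_tail_rec[of p' r k m'] unfolding b c Suc diff_Suc_1 by linarith
    then have "(1 - p') * (b - c) \<le> p' * (a - b)" unfolding right_diff_distrib left_diff_distrib by linarith
    \<comment> \<open>Here \<open>p' \<le> 1 / 2\<close> allows \<open>p'\<close> to be replaced by
      \<open>1 - p'\<close>, which then cancels.\<close>
    also have "\<dots> \<le> (1 - p') * (a - b)" by (rule mult_right_mono) (use p' ba in linarith)+
    finally show ?thesis by (rule mult_left_le_imp_le) (use p' in linarith)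
  qed
qed

text \<open>An unrevealed edge with both ends in \<open>W\<close> counts twice, which is why a
  collision may use up two half-edges.\<close>

definition half_edges :: "nat \<Rightarrow> nat set set \<Rightarrow> nat set \<Rightarrow> nat" where
  "half_edges d R W = (\<Sum>v\<in>W. d - degree R v)"

lemma half_edges_reveal:
  assumes "finite W" "finite R" "u \<in> W" "u \<noteq> w" "{u, w} \<notin> R" "degree R u < d"
  shows "Suc (half_edges d (insert {u, w} R) W) \<le> half_edges d R W"
    and "half_edges d R W \<le> Suc (Suc (half_edges d (insert {u, w} R) W))"
    and "w \<notin> W \<Longrightarrow> Suc (half_edges d (insert {u, w} R) W) = half_edges d R W"
proof -
  let ?R = "insert {u, w} R"
  have deg: "degree ?R v = degree R v + of_bool (v = u \<or> v = w)" for v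
    using degree_insert[OF assms(2,5), of v] by simp
  have split: "half_edges d X W = (d - degree X u) + (\<Sum>v\<in>W - {u}. d - degree X v)" for X
    unfolding half_edges_def using assms by (intro sum.remove) auto
  have u: "d - degree R u = Suc (d - degree ?R u)" using assms deg[of u] by simp
  have le: "(\<Sum>v\<in>W - {u}. d - degree ?R v) \<le> (\<Sum>v\<in>W - {u}. d - degree R v)"
    using deg by (intro sum_mono) auto
  then show "Suc (half_edges d ?R W) \<le> half_edges d R W"
    unfolding split[of R] split[of ?R] u by simp
  have eq: "(\<Sum>v\<in>V. d - degree ?R v) = (\<Sum>v\<in>V. d - degree R v)" if "u \<notin> V" "w \<notin> V" for V
    using that deg by (intro sum.cong refl) auto
  show "Suc (half_edges d ?R W) = half_edges d R W" if "w \<notin> W"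
    unfolding split[of R] split[of ?R] u using eq[of "W - {u}"] that by simp
  show "half_edges d R W \<le> Suc (Suc (half_edges d ?R W))"
  proof (cases "w \<in> W")
    case True
    have "(\<Sum>v\<in>W - {u}. d - degree X v) = (d - degree X w) + (\<Sum>v\<in>W - {u} - {w}. d - degree X v)" for X
      using assms True by (intro sum.remove) auto
    moreover have "d - degree R w \<le> Suc (d - degree ?R w)" using deg[of w] by simp
    ultimately show ?thesis
      unfolding split[of R] split[of ?R] u using eq[of "W - {u} - {w}"] by simp
  next
    case False
    then show ?thesis unfolding split[of R] split[of ?R] u using eq[of "W - {u}"] by simp
  qed
qed


lemma card_Union_edges_le:
  assumes "simple_graph n R"
  shows "card (\<Union>R) \<le> 2 * card R"
proof -
  have "card (\<Union>R) \<le> (\<Sum>e\<in>R. card e)"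
    by (rule card_Union_le_sum_card)
  also have "\<dots> = (\<Sum>e\<in>R. 2)" using assms by (intro sum.cong) (auto simp: simple_graph_def)
  finally show ?thesis by simp
qed

lemma simple_graph_insert:
  assumes "simple_graph n R" "u \<in> {1..n}" "w \<in> {1..n}" "u \<noteq> w"
  shows "simple_graph n (insert {u, w} R)"
  using assms unfolding simple_graph_def by simp

text \<open>A crude bound which makes \<open>2 ^ n - card R\<close> a decreasing measure for the
  exploration.\<close>

lemma simple_graph_Pow: "simple_graph n R \<Longrightarrow> card R \<le> 2 ^ n"
  using card_mono[of "Pow {1..n}" R] by (auto simp: simple_graph_def card_Pow)

lemma half_edges_insert_fresh:
  assumes "finite W" "finite R" "w \<notin> W" "w \<notin> \<Union>R" "u \<noteq> w" "{u, w} \<notin> R" "d = Suc r"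
  shows "half_edges d (insert {u, w} R) (insert w W) = half_edges d (insert {u, w} R) W + r"
proof -
  have "degree R w = 0" unfolding degree_def using assms(4) by (auto simp: card_eq_0_iff)
  then have "degree (insert {u, w} R) w = 1" using degree_insert[OF assms(2,6), of w] by simp
  then show ?thesis unfolding half_edges_def using assms by simp
qed

text \<open>Edges are open with probability \<open>p\<close>, and \<open>p'\<close> is the parameter
  of the branching process used for comparison. \<open>\<eta>\<close> bounds the weight of
  collisions, \<open>\<mu>\<close> is the mean progeny of a half-edge, and \<open>s\<close> is the
  budget of vertices. \<open>size\<close> permits the switchings, \<open>eta\<close> is the union
  bound over touched vertices, and \<open>small\<close> guarantees an untouched vertex for the next
  cluster.\<close>

locale exploration =
  fixes d r n A :: nat and p p' \<eta> \<mu> s :: real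
  assumes d: "d = Suc r"
    and A: "A > 0"
    and p: "0 \<le> p'" "0 \<le> \<eta>" "p' + 2 * \<eta> \<le> p" "p \<le> 1 / 2"
    and mu: "0 \<le> \<mu>" "p + p * \<mu> * real r = \<mu>"
    and s: "0 < s"
    and size: "real n + 2 * real d * s + real (2 * (d * Suc d)) \<le> real (n * d)"
    and eta: "real ((2 * d + 1) * d * d) * s \<le> \<eta> * real n"
    and small: "real (2 * d + 1) * s \<le> real n"
begin

text \<open>\<open>t\<close> vertices have been reached, the current cluster has \<open>m\<close> unrevealed half-edges and \<open>j\<close>
  clusters are still to be started. The numerator of \<open>cost\<close> bounds the expected final number of
  reached vertices, so by Markov's inequality \<open>cost\<close> pays for the event that it exceeds \<open>s\<close>.\<close>

definition cost :: "nat \<Rightarrow> nat \<Rightarrow> nat \<Rightarrow> real" where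
  "cost t j m = (real t + real j + \<mu> * (real m + real j * real d)) / s"

text \<open>The comparison probability that a fresh cluster reaches \<open>A\<close> vertices; its
  root counts, hence \<open>A - 1\<close>.\<close>

definition success :: real where
  "success = progeny_tail p' r (A - 1) d"

abbreviation total_miss :: "nat set set \<Rightarrow> nat set set \<Rightarrow> real" where
  "total_miss Op R \<equiv> (\<Sum>G\<in>extensions d n R. miss_prob p n A Op R G)"

text \<open>As if independent, the current cluster falls short of its \<open>k\<close> missing
  vertices and the \<open>j\<close> later ones fail; \<open>cost\<close> pays for overrunning the
  budget.\<close>

abbreviation bound :: "nat \<Rightarrow> nat \<Rightarrow> nat \<Rightarrow> nat \<Rightarrow> real" where
  "bound t j k m \<equiv> (1 - progeny_tail p' r k m) * (1 - success) ^ j + cost t j m"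

lemma n_pos: "n > 0"
proof -
  have "0 < real (2 * d + 1) * s" using s by simp
  then show ?thesis using small by linarith
qed

lemma p_bounds: "0 \<le> p" "p \<le> 1" "0 \<le> p'" "p' \<le> 1" "p' \<le> 1 / 2"
  using p by linarith+

lemma success_bounds: "0 \<le> success" "success \<le> 1"
  unfolding success_def using progeny_tail_bounds[OF p_bounds(3,4)] by blast+

lemma cost_nonneg: "0 \<le> cost t j m"
  unfolding cost_def using mu s by simp

lemma cost_mono: "m \<le> m' \<Longrightarrow> cost t j m \<le> cost t j m'"
  unfolding cost_def using mu s by (intro divide_right_mono add_left_mono mult_left_mono) auto

text \<open>The fixed-point equation for \<open>\<mu>\<close> makes \<open>cost\<close> a martingale
  along collision-free steps.\<close>

lemma cost_reveal: "p * cost (Suc t) j (m + r) + (1 - p) * cost t j m = cost t j (Suc m)"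
proof -
  have "p * (real (Suc t) + real j + \<mu> * (real (m + r) + real j * real d))
      + (1 - p) * (real t + real j + \<mu> * (real m + real j * real d))
    = real t + real j + \<mu> * (real m + real j * real d) + (p + p * \<mu> * real r)"
    by (simp add: algebra_simps)
  also have "\<dots> = real t + real j + \<mu> * (real (Suc m) + real j * real d)"
    unfolding mu(2) by (simp add: algebra_simps)
  finally show ?thesis
    unfolding cost_def times_divide_eq_right add_divide_distrib[symmetric] by (rule arg_cong)
qed

lemma cost_restart: "cost (Suc t) j d = cost t (Suc j) 0"
  unfolding cost_def by (simp add: algebra_simps)

lemma total_miss_le: "total_miss Op R \<le> real (card (extensions d n R))"
  using sum_mono[of "extensions d n R" "miss_prob p n A Op R" "\<lambda>_. 1"] miss_prob_le_1 by simp

lemma bound_ge_1I: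
  assumes "1 \<le> b"
  shows "total_miss Op R \<le> real (card (extensions d n R)) * b"
  using total_miss_le[of Op R] mult_left_mono[OF assms, of "real (card (extensions d n R))"] by simp

text \<open>Union bound: revealed edges and the current cluster touch at most
  \<open>(2 * d + 1) * s\<close> vertices, and by the switching each is hit with weight at most
  \<open>d * d / n\<close>.\<close>

lemma sum_touched_le:
  assumes "simple_graph n R" "u \<in> {1..n}" "finite W" "real t < s"
    "card R \<le> d * t" "card W \<le> t" "V \<subseteq> \<Union>R \<union> W"
    "V \<subseteq> {w. w \<in> {1..n} \<and> {u, w} \<notin> R \<and> w \<noteq> u}"
  shows "(\<Sum>w\<in>V. real (card (extensions d n (insert {u, w} R))))
    \<le> \<eta> * real (card (extensions d n R))"
proof -
  have fin: "finite R" "finite (\<Union>R \<union> W)"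
    using finite_simple_graph[OF assms(1)] assms(1,3)
    by (auto simp: simple_graph_def intro: finite_subset)
  have "card V \<le> card (\<Union>R \<union> W)" using fin assms(7) by (intro card_mono)
  also have "\<dots> \<le> 2 * card R + card W"
    using card_Un_le[of "\<Union>R" W] card_Union_edges_le[OF assms(1)] by linarith
  also have "\<dots> \<le> (2 * d + 1) * t" using assms(5,6) by simp
  finally have "real (card V) \<le> real ((2 * d + 1) * t)" by (rule of_nat_mono)
  also have "\<dots> \<le> real (2 * d + 1) * s" unfolding of_nat_mult using assms(4) by (intro mult_left_mono) auto
  finally have V: "real (card V) \<le> real (2 * d + 1) * s" .
  have "real (card R) \<le> real d * real t" using assms(5) by (simp flip: of_nat_mult)
  also have "\<dots> \<le> real d * s" using assms(4) by (intro mult_left_mono) auto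
  finally have "real (n + 2 * card R + 2 * (d * Suc d)) \<le> real (n * d)"
    using size by simp
  then have big: "n + 2 * card R + 2 * (d * Suc d) \<le> n * d" by (simp only: of_nat_le_iff)
  let ?N = "\<lambda>R. real (card (extensions d n R))"
  have one: "real n * ?N (insert {u, w} R) \<le> real (d * d) * ?N R" if "w \<in> V" for w
  proof -
    have w: "w \<in> {1..n}" "{u, w} \<notin> R" "w \<noteq> u" using that assms(8) by auto
    have "n * card (extensions d n (insert {u, w} R)) \<le> d * d * card (extensions d n R)"
      using w by (intro card_extensions_insert_le[OF assms(2) _ _ _ fin(1) big]) auto
    then show ?thesis by (simp flip: of_nat_mult)
  qed
  have "real n * (\<Sum>w\<in>V. ?N (insert {u, w} R)) \<le> (\<Sum>w\<in>V. real (d * d) * ?N R)"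
    unfolding sum_distrib_left using one by (rule sum_mono)
  also have "\<dots> = real (card V) * (real (d * d) * ?N R)" by simp
  also have "\<dots> \<le> (real (2 * d + 1) * s) * (real (d * d) * ?N R)" using V by (intro mult_right_mono) auto
  also have "\<dots> = (real ((2 * d + 1) * d * d) * s) * ?N R" by (simp add: algebra_simps)
  also have "\<dots> \<le> \<eta> * real n * ?N R" using eta by (intro mult_right_mono) auto
  finally have "real n * (\<Sum>w\<in>V. ?N (insert {u, w} R)) \<le> real n * (\<eta> * ?N R)" by (simp only: mult.assoc mult.left_commute)
  then show ?thesis using n_pos by simp
qed

text \<open>Average over the revealed neighbour \<open>w\<close> of \<open>u\<close>. A fresh
  \<open>w\<close> reproduces the branching recursion at \<open>p\<close>; a touched one costs at
  most an extra \<open>D\<close>, with total weight at most \<open>\<eta>\<close>. The gap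
  \<open>p - p' \<ge> 2 * \<eta>\<close> repays this.\<close>

lemma total_miss_reveal:
  assumes "simple_graph n R" "u \<in> {1..n}" "finite W" "real t < s" "degree R u < d" "k > 0"
    "card R \<le> d * t" "card W \<le> t" "0 \<le> X"
    and fresh: "\<And>w. \<lbrakk>w \<in> {1..n}; {u, w} \<notin> R; w \<noteq> u; w \<notin> \<Union>R; w \<notin> W\<rbrakk> \<Longrightarrow>
      total_miss (insert {u, w} Op) (insert {u, w} R) \<le> real (card (extensions d n (insert {u, w} R))) *
          ((1 - progeny_tail p' r (k - 1) (m + r)) * X + cost (Suc t) j (m + r))
      \<and> total_miss Op (insert {u, w} R) \<le> real (card (extensions d n (insert {u, w} R))) *
          ((1 - progeny_tail p' r k m) * X + cost t j m)"
    and touched: "\<And>w. \<lbrakk>w \<in> {1..n}; {u, w} \<notin> R; w \<noteq> u; w \<in> \<Union>R \<union> W\<rbrakk> \<Longrightarrow>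
      total_miss Op (insert {u, w} R) \<le> real (card (extensions d n (insert {u, w} R))) *
          ((1 - progeny_tail p' r k (m - 1)) * X + cost t j (Suc m))"
  shows "total_miss Op R \<le> real (card (extensions d n R)) *
    ((1 - progeny_tail p' r k (Suc m)) * X + cost t j (Suc m))"
proof -
  define a b c where "a = progeny_tail p' r (k - 1) (m + r)" and "b = progeny_tail p' r k m"
    and "c = progeny_tail p' r k (m - 1)"
  note abc = progeny_tail_collision[OF p_bounds(3,5) assms(6) a_def b_def c_def]
  define L where "L = cost t j (Suc m)"
  \<comment> \<open>\<open>Y\<close> is the value for a fresh neighbour, \<open>D\<close> the
    surcharge for a touched one.\<close>
  define Y where "Y = (1 - (p * a + (1 - p) * b)) * X + L"
  define D where "D = 2 * ((a - b) * X)"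
  have D: "0 \<le> D" using abc assms(9) by (simp add: D_def)
  let ?N = "\<lambda>R. real (card (extensions d n R))"
  let ?Q = "{w. w \<in> {1..n} \<and> {u, w} \<notin> R \<and> w \<noteq> u}"
  let ?T = "?Q \<inter> (\<Union>R \<union> W)"
  have one: "(\<Sum>G\<in>extensions d n (insert {u, w} R). miss_prob p n A Op R G)
      \<le> ?N (insert {u, w} R) * Y + (if w \<in> ?T then ?N (insert {u, w} R) * D else 0)" if w: "w \<in> ?Q" for w
  proof -
    let ?R = "insert {u, w} R" and ?O = "insert {u, w} Op"
    have split: "(\<Sum>G\<in>extensions d n ?R. miss_prob p n A Op R G)
      = p * total_miss ?O ?R + (1 - p) * total_miss Op ?R"
      unfolding sum_distrib_left sum.distrib[symmetric]
    proof (rule sum.cong[OF refl])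
      fix G assume G: "G \<in> extensions d n ?R"
      show "miss_prob p n A Op R G = p * miss_prob p n A ?O ?R G + (1 - p) * miss_prob p n A Op ?R G"
        using extensionsD(2,3)[OF G] w p_bounds by (intro miss_prob_reveal) auto
    qed
    show ?thesis
    proof (cases "w \<in> \<Union>R \<union> W")
      case False
      have "total_miss ?O ?R \<le> ?N ?R * ((1 - a) * X + cost (Suc t) j (m + r))"
        "total_miss Op ?R \<le> ?N ?R * ((1 - b) * X + cost t j m)"
        using fresh[of w] w False unfolding a_def b_def by blast+
      then have "p * total_miss ?O ?R + (1 - p) * total_miss Op ?R
        \<le> p * (?N ?R * ((1 - a) * X + cost (Suc t) j (m + r))) + (1 - p) * (?N ?R * ((1 - b) * X + cost t j m))"
        using p_bounds by (intro add_mono mult_left_mono) auto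
      also have "\<dots> = ?N ?R * ((1 - (p * a + (1 - p) * b)) * X
          + (p * cost (Suc t) j (m + r) + (1 - p) * cost t j m))"
        by (simp add: algebra_simps)
      also have "\<dots> = ?N ?R * Y" unfolding cost_reveal Y_def L_def ..
      finally show ?thesis using split False by simp
    next
      case True
      \<comment> \<open>After a collision the edge is treated as closed, since an open one can only
        help.\<close>
      have "total_miss ?O ?R \<le> total_miss Op ?R"
        using n_pos by (intro sum_mono miss_prob_anti) auto
      then have "p * total_miss ?O ?R + (1 - p) * total_miss Op ?R
          \<le> p * total_miss Op ?R + (1 - p) * total_miss Op ?R"
        using p_bounds by (intro add_right_mono mult_left_mono)
      also have "\<dots> = total_miss Op ?R" by (simp add: algebra_simps)
      also have "\<dots> \<le> ?N ?R * ((1 - c) * X + L)"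
        using touched[of w] w True unfolding c_def L_def by blast
      also have "\<dots> \<le> ?N ?R * (Y + D)"
      proof (rule mult_left_mono)
        have "p * (a - b) \<le> 1 * (a - b)" using abc p_bounds by (intro mult_right_mono) auto
        then have "p * a + (1 - p) * b - c \<le> 2 * (a - b)" using abc by (simp add: algebra_simps)
        then have "(p * a + (1 - p) * b - c) * X \<le> 2 * (a - b) * X" using assms(9) by (rule mult_right_mono)
        then show "(1 - c) * X + L \<le> Y + D" unfolding Y_def D_def by (simp add: algebra_simps)
      qed simp
      finally show ?thesis using split w True by (simp add: distrib_left)
    qed
  qed
  define h where "h = real (d - degree R u)"
  have h: "h \<ge> 1" using assms(5) by (simp add: h_def)
  have "h * total_miss Op R = (\<Sum>w\<in>?Q. \<Sum>G\<in>extensions d n (insert {u, w} R). miss_prob p n A Op R G)"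
    unfolding h_def by (rule sum_extensions_reveal[OF assms(2), symmetric])
  also have "\<dots> \<le> (\<Sum>w\<in>?Q. ?N (insert {u, w} R) * Y + (if w \<in> ?T then ?N (insert {u, w} R) * D else 0))"
    using one by (rule sum_mono)
  also have "\<dots> = (\<Sum>w\<in>?Q. ?N (insert {u, w} R)) * Y + (\<Sum>w\<in>?T. ?N (insert {u, w} R)) * D"
  proof -
    have "(\<Sum>w\<in>?Q. if w \<in> ?T then ?N (insert {u, w} R) * D else 0) = (\<Sum>w\<in>?T. ?N (insert {u, w} R) * D)"
      by (rule sum.mono_neutral_cong_right) auto
    then show ?thesis by (simp add: sum.distrib sum_distrib_right)
  qed
  also have "(\<Sum>w\<in>?Q. ?N (insert {u, w} R)) = h * ?N R"
    using sum_extensions_reveal[OF assms(2), where R = R and d = d and f = "\<lambda>_. 1"] by (simp add: h_def)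
  also have "(\<Sum>w\<in>?T. ?N (insert {u, w} R)) * D \<le> \<eta> * ?N R * D"
    using assms(1-4,7,8) D by (intro mult_right_mono sum_touched_le) auto
  \<comment> \<open>The weight of the touched neighbours was bounded without dividing by
    \<open>h\<close>; as \<open>h \<ge> 1\<close>, a factor \<open>h\<close> may be added here so
    that it cancels throughout.\<close>
  also have "\<eta> * ?N R * D \<le> h * (\<eta> * ?N R * D)"
    using h p D mult_right_mono[of 1 h "\<eta> * ?N R * D"] by simp
  finally have "h * total_miss Op R \<le> h * (?N R * (Y + \<eta> * D))" by (simp add: algebra_simps)
  then have "total_miss Op R \<le> ?N R * (Y + \<eta> * D)" using h by simp
  also have "\<dots> \<le> ?N R * ((1 - progeny_tail p' r k (Suc m)) * X + L)"
  proof (rule mult_left_mono)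
    have "(p' + 2 * \<eta>) * ((a - b) * X) \<le> p * ((a - b) * X)"
      using p abc assms(9) by (intro mult_right_mono) auto
    then show "Y + \<eta> * D \<le> (1 - progeny_tail p' r k (Suc m)) * X + L"
      unfolding progeny_tail_rec a_def[symmetric] b_def[symmetric] Y_def D_def
      by (simp add: algebra_simps)
  qed simp
  finally show ?thesis unfolding L_def .
qed

text \<open>Induction along the exploration: every step reveals an edge or starts one of the
  \<open>j\<close> remaining clusters. Each of the \<open>t\<close> reached vertices supplies at
  most \<open>d\<close> half-edges, which is the invariant bounding \<open>card R\<close>.\<close>

lemma total_miss_le_bound:
  assumes "simple_graph n R" "W \<subseteq> {1..n}" "W = {} \<or> (\<exists>v\<in>W. W \<subseteq> reach Op {v})"
    "card W + k = A" "card R + half_edges d R W \<le> d * t" "card W \<le> t"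
  shows "total_miss Op R \<le> real (card (extensions d n R)) * bound t j k (half_edges d R W)"
  using assms
proof (induction "j + (2 ^ n - card R)" arbitrary: j R W Op k t rule: less_induct)
  case less
  note IH = less(1) and R = less(2) and W = less(3,4,5) and t = less(6,7)
  have fW: "finite W" using finite_subset[OF W(1)] by simp
  have fR: "finite R" using finite_simple_graph[OF R] .
  have nn: "0 \<le> (1 - progeny_tail p' r k (half_edges d R W)) * (1 - success) ^ j"
    using success_bounds progeny_tail_bounds[OF p_bounds(3,4)] by (intro mult_nonneg_nonneg) auto
  show ?case
  proof (cases "real t < s")
    case False
    \<comment> \<open>The budget is exhausted, and \<open>cost\<close> alone makes the bound
      trivial.\<close>
    then have "1 \<le> real t / s" using s by simp
    also have "\<dots> \<le> cost t j (half_edges d R W)"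
      unfolding cost_def using s mu by (intro divide_right_mono) auto
    finally show ?thesis using nn by (intro bound_ge_1I) linarith
  next
    case ts: True
    show ?thesis
    proof (cases "k = 0")
      case True
      then have "W \<noteq> {}" using W(3) A by auto
      then obtain v where v: "v \<in> W" "W \<subseteq> reach Op {v}" using W(2) by blast
      have "total_miss Op R = 0"
        using miss_prob_eq_0[OF v W(1)] W(3) True by (intro sum.neutral) auto
      moreover have "0 \<le> real (card (extensions d n R)) * bound t j k (half_edges d R W)"
        using nn cost_nonneg by (intro mult_nonneg_nonneg) auto
      ultimately show ?thesis by linarith
    next
      case k: False
      show ?thesis
      proof (cases "half_edges d R W")
        case 0
        then have T: "progeny_tail p' r k (half_edges d R W) = 0"
          using k progeny_tail_0_right[of k] by simp
        show ?thesis
        proof (cases j)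
          case 0
          then show ?thesis using T cost_nonneg[of t j] by (intro bound_ge_1I) simp
        next
          case (Suc j')
          \<comment> \<open>The current cluster is finished. Fewer than \<open>n\<close> vertices
            are touched, so the next one starts at a vertex with all \<open>d\<close> half-edges
            unrevealed.\<close>
          have "card (\<Union>R \<union> W) \<le> 2 * card R + card W"
            using card_Un_le[of "\<Union>R" W] card_Union_edges_le[OF R] by linarith
          also have "\<dots> \<le> (2 * d + 1) * t" using t by simp
          finally have "real (card (\<Union>R \<union> W)) \<le> real (2 * d + 1) * real t"
            unfolding of_nat_mult[symmetric] by (rule of_nat_mono)
          also have "\<dots> < real (2 * d + 1) * s" using ts by (intro mult_strict_left_mono) auto
          finally have "card (\<Union>R \<union> W) < card {1..n}" using small by simp
          moreover have "finite (\<Union>R \<union> W)"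
            using fW R by (intro finite_UnI finite_subset[of "\<Union>R" "{1..n}"]) (auto simp: simple_graph_def)
          ultimately have "\<not> {1..n} \<subseteq> \<Union>R \<union> W"
            using card_mono[of "\<Union>R \<union> W" "{1..n}"] by linarith
          then obtain v where v: "v \<in> {1..n}" "v \<notin> \<Union>R" by blast
          have "degree R v = 0" unfolding degree_def using v(2) by (auto simp: card_eq_0_iff)
          then have h: "half_edges d R {v} = d" by (simp add: half_edges_def)
          have "total_miss Op R \<le> real (card (extensions d n R)) * bound (Suc t) j' (A - 1) (half_edges d R {v})"
            using R v(1) t A h reach_superset[of "{v}" Op] by (intro IH) (auto simp: Suc)
          moreover have "bound (Suc t) j' (A - 1) d = (1 - 0) * (1 - success) ^ j + cost t j 0"
            unfolding success_def[symmetric] Suc cost_restart by simp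
          ultimately show ?thesis unfolding T h using \<open>half_edges d R W = 0\<close> by simp
        qed
      next
        case (Suc m)
        show ?thesis
        proof (cases "extensions d n R = {}")
          case True
          then show ?thesis by simp
        next
          case False
          have "\<exists>u\<in>W. d - degree R u \<noteq> 0"
          proof (rule ccontr)
            assume "\<not> ?thesis"
            then have "half_edges d R W = 0" unfolding half_edges_def by (intro sum.neutral) auto
            then show False using Suc by simp
          qed
          then obtain u where u: "u \<in> W" "degree R u < d" by auto
          have u': "u \<in> {1..n}" using u W by auto
          obtain v where v: "v \<in> W" "W \<subseteq> reach Op {v}" using W(2) u by blast
          show ?thesis
            unfolding Suc
          proof (rule total_miss_reveal[OF R u' fW ts u(2) _ _ t(2)])
            show "k > 0" "card R \<le> d * t" "0 \<le> (1 - success) ^ j"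
              using k t success_bounds by auto
          next
            fix w assume w: "w \<in> {1..n}" "{u, w} \<notin> R" "w \<noteq> u" "w \<notin> \<Union>R" "w \<notin> W"
            let ?R = "insert {u, w} R"
            have R': "simple_graph n ?R" using R u' w by (intro simple_graph_insert) auto
            have cR: "card ?R = Suc (card R)" using fR w by simp
            then have meas: "j + (2 ^ n - card ?R) < j + (2 ^ n - card R)"
              using simple_graph_Pow[OF R'] by simp
            have hm: "half_edges d ?R W = m"
              using half_edges_reveal(3)[OF fW fR u(1) w(3)[symmetric] w(2) u(2) w(5)] Suc by simp
            have hm': "half_edges d ?R (insert w W) = m + r"
              using half_edges_insert_fresh[OF fW fR w(5,4) w(3)[symmetric] w(2) d] hm by simp
            have "insert w W \<subseteq> reach (insert {u, w} Op) {v}"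
            proof -
              have "W \<subseteq> reach (insert {u, w} Op) {v}"
                using v reach_mono[of Op "insert {u, w} Op" "{v}"] by blast
              moreover from this have "w \<in> reach (insert {u, w} Op) {v}"
                using u(1) by (intro reach_step[of u _ _ w]) auto
              ultimately show ?thesis by simp
            qed
            then have "total_miss (insert {u, w} Op) ?R \<le> real (card (extensions d n ?R)) *
                bound (Suc t) j (k - 1) (half_edges d ?R (insert w W))"
              using W t w k fW v(1) hm' cR Suc d by (intro IH meas R') auto
            moreover have "total_miss Op ?R \<le> real (card (extensions d n ?R)) *
                bound t j k (half_edges d ?R W)"
              using W t hm cR Suc by (intro IH meas R') auto
            ultimately show "total_miss (insert {u, w} Op) ?R \<le> real (card (extensions d n ?R)) *
                bound (Suc t) j (k - 1) (m + r)
              \<and> total_miss Op ?R \<le> real (card (extensions d n ?R)) * bound t j k m"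
              unfolding hm hm' by blast
          next
            \<comment> \<open>At a collision \<open>W\<close> and \<open>t\<close> stay as they are,
              and one or two half-edges are lost.\<close>
            fix w assume w: "w \<in> {1..n}" "{u, w} \<notin> R" "w \<noteq> u" "w \<in> \<Union>R \<union> W"
            let ?R = "insert {u, w} R"
            have R': "simple_graph n ?R" using R u' w by (intro simple_graph_insert) auto
            have cR: "card ?R = Suc (card R)" using fR w by simp
            then have meas: "j + (2 ^ n - card ?R) < j + (2 ^ n - card R)"
              using simple_graph_Pow[OF R'] by simp
            define l where "l = half_edges d ?R W"
            have l: "Suc l \<le> Suc m" "Suc m \<le> Suc (Suc l)"
              using half_edges_reveal(1,2)[OF fW fR u(1) w(3)[symmetric] w(2) u(2)] Suc
              unfolding l_def by simp_all
            have "total_miss Op ?R \<le> real (card (extensions d n ?R)) * bound t j k (half_edges d ?R W)"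
              using W t l cR Suc by (intro IH meas R') (auto simp: l_def)
            also have "\<dots> \<le> real (card (extensions d n ?R)) *
                ((1 - progeny_tail p' r k (m - 1)) * (1 - success) ^ j + cost t j (Suc m))"
              unfolding l_def[symmetric]
              using l success_bounds progeny_tail_mono[OF p_bounds(3,4), of "m - 1" l r k]
              by (intro mult_left_mono add_mono mult_right_mono cost_mono) auto
            finally show "total_miss Op ?R \<le> real (card (extensions d n ?R)) *
                ((1 - progeny_tail p' r k (m - 1)) * (1 - success) ^ j + cost t j (Suc m))" .
          qed
        qed
      qed
    qed
  qed
qed

text \<open>Start with nothing revealed and an empty cluster: without half-edges its tail is 0, so
  all \<open>j\<close> clusters come from the restart step.\<close>

lemma prob_largest_component_less:
  assumes "regular_graphs d n \<noteq> {}"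
  shows "measure_pmf.prob (percolated_regular_graph d n p) {H. largest_component n H < A}
    \<le> (1 - success) ^ j + (real j + \<mu> * (real j * real d)) / s"
proof -
  have X: "extensions d n {} = regular_graphs d n" by (simp add: extensions_def)
  have "total_miss {} {} \<le> real (card (extensions d n {})) * bound 0 j A (half_edges d {} {})"
    by (rule total_miss_le_bound) (auto simp: simple_graph_def half_edges_def)
  also have "bound 0 j A (half_edges d {} {}) = (1 - success) ^ j + (real j + \<mu> * (real j * real d)) / s"
    using progeny_tail_0_right[OF A] by (simp add: half_edges_def cost_def)
  finally have "total_miss {} {} \<le> real (card (regular_graphs d n)) *
    ((1 - success) ^ j + (real j + \<mu> * (real j * real d)) / s)" unfolding X .
  moreover have "card (regular_graphs d n) > 0"
    using assms finite_regular_graphs by (simp add: card_gt_0_iff)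
  ultimately show ?thesis
    unfolding prob_percolated_regular_graph[OF assms] X
    by (simp add: miss_prob_def divide_le_eq mult.commute)
qed

end

section \<open>Existence of regular graphs and monotonicity in the edge probability\<close>

text \<open>The circulant graph of a symmetric set of nonzero residues modulo \<open>n\<close>: a
  neighbour \<open>x\<close> of \<open>v\<close> corresponds to the representative of
  \<open>v - x\<close> in \<open>S\<close>.\<close>

lemma circulant_regular:
  assumes S: "S \<subseteq> {1..<n}" "\<And>s. s \<in> S \<Longrightarrow> n - s \<in> S"
  shows "{{u, v} | u v. 1 \<le> u \<and> u < v \<and> v \<le> n \<and> v - u \<in> S} \<in> regular_graphs (card S) n"
    (is "?G \<in> _")
proof -
  have sg: "simple_graph n ?G" by (auto simp: simple_graph_def)
  have "degree ?G v = card S" if v: "v \<in> {1..n}" for v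
  proof -
    have nb: "{x. {v, x} \<in> ?G} = {x. 1 \<le> x \<and> x < v \<and> v - x \<in> S} \<union> {x. v < x \<and> x \<le> n \<and> x - v \<in> S}"
      using v by (auto simp: doubleton_eq_iff)
    have "bij_betw (\<lambda>x. if x < v then v - x else n - (x - v)) {x. {v, x} \<in> ?G} S"
    proof (rule bij_betw_byWitness[where f' = "\<lambda>s. if s < v then v - s else v + (n - s)"])
      show "\<forall>x\<in>{x. {v, x} \<in> ?G}. (if (if x < v then v - x else n - (x - v)) < v
          then v - (if x < v then v - x else n - (x - v))
          else v + (n - (if x < v then v - x else n - (x - v)))) = x"
        unfolding nb using v by auto
      show "\<forall>s\<in>S. (if (if s < v then v - s else v + (n - s)) < v
          then v - (if s < v then v - s else v + (n - s))
          else n - ((if s < v then v - s else v + (n - s)) - v)) = s"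
        using v S(1) by fastforce
      show "(\<lambda>x. if x < v then v - x else n - (x - v)) ` {x. {v, x} \<in> ?G} \<subseteq> S"
      proof (rule image_subsetI)
        fix x assume "x \<in> {x. {v, x} \<in> ?G}"
        then have "x < v \<and> v - x \<in> S \<or> v < x \<and> x - v \<in> S" unfolding nb by auto
        then show "(if x < v then v - x else n - (x - v)) \<in> S"
        proof (elim disjE conjE)
          assume "v < x" "x - v \<in> S"
          then have "n - (x - v) \<in> S" "\<not> x < v" by (auto intro: S(2) simp del: diff_diff_right)
          then show ?thesis unfolding if_not_P[OF \<open>\<not> x < v\<close>] by blast
        qed simp
      qed
      show "(\<lambda>s. if s < v then v - s else v + (n - s)) ` S \<subseteq> {x. {v, x} \<in> ?G}"
      proof (rule image_subsetI)
        fix s assume s: "s \<in> S"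
        then have s': "1 \<le> s" "s < n" using S(1) by auto
        show "(if s < v then v - s else v + (n - s)) \<in> {x. {v, x} \<in> ?G}"
          unfolding nb using s s' v S(2)[OF s] by (cases "s < v") auto
      qed
    qed
    then have "card {x. {v, x} \<in> ?G} = card S" by (rule bij_betw_same_card)
    then show ?thesis using card_neighbours[OF sg] by simp
  qed
  then show ?thesis using sg by (simp add: regular_graphs_def)
qed

lemma regular_graphs_nonempty:
  assumes "d < n" "even (n * d)"
  shows "regular_graphs d n \<noteq> {}"
proof -
  define h where "h = d div 2"
  \<comment> \<open>Residues are taken in pairs of opposite sign; for odd \<open>d\<close> the
    number \<open>n\<close> is even, and the self-inverse residue \<open>n div 2\<close> is
    added.\<close>
  define S where "S = {1..h} \<union> {n - h..<n} \<union> (if odd d then {n div 2} else {})"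
  have h: "2 * h \<le> d" "odd d \<Longrightarrow> d = Suc (2 * h)" "even d \<Longrightarrow> d = 2 * h" by (auto simp: h_def)
  have n: "odd d \<Longrightarrow> n = 2 * (n div 2)" using assms(2) by auto
  have "S \<subseteq> {1..<n}" using assms(1) h n by (auto simp: S_def)
  moreover have "n - s \<in> S" if "s \<in> S" for s
    using that assms(1) h n by (auto simp: S_def split: if_splits)
  moreover have "card S = d"
  proof -
    have 1: "card ({1..h} \<union> {n - h..<n}) = 2 * h"
      using assms(1) h(1) by (subst card_Un_disjoint) auto
    show ?thesis
    proof (cases "odd d")
      case True
      have "n div 2 \<notin> {1..h} \<union> {n - h..<n}" using assms(1) h(2)[OF True] n[OF True] by auto
      then have "card S = Suc (2 * h)" using 1 True by (simp add: S_def)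
      then show ?thesis using h(2)[OF True] by simp
    next
      case False
      then show ?thesis using 1 h(3) by (simp add: S_def)
    qed
  qed
  ultimately show ?thesis using circulant_regular[of S n] by auto
qed

text \<open>An edgewise induction in place of a coupling: for each edge, weight
  \<open>p' - p\<close> moves from closed to open, which cannot favour a decreasing event.\<close>

lemma prob_percolation_antimono:
  assumes "finite E" "0 \<le> p" "p \<le> p'" "p' \<le> 1"
    and "\<And>\<omega> \<omega>'. \<omega> \<subseteq> \<omega>' \<Longrightarrow> Q \<omega>' \<Longrightarrow> Q \<omega>"
  shows "measure_pmf.prob (percolation p' E) {\<omega>. Q \<omega>} \<le> measure_pmf.prob (percolation p E) {\<omega>. Q \<omega>}"
  using assms(1,5)
proof (induction E arbitrary: Q rule: finite_induct)
  case empty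
  then show ?case by (simp add: percolation_empty)
next
  case (insert e E Q)
  let ?P = "\<lambda>p Q. measure_pmf.prob (percolation p E) {\<omega>. Q \<omega>}"
  have 1: "?P p' (\<lambda>\<omega>. Q (insert e \<omega>)) \<le> ?P p (\<lambda>\<omega>. Q (insert e \<omega>))"
    by (rule insert.IH) (rule insert.prems, auto)
  have 2: "?P p' Q \<le> ?P p Q" by (rule insert.IH[OF insert.prems])
  have 3: "?P p (\<lambda>\<omega>. Q (insert e \<omega>)) \<le> ?P p Q"
    using insert.prems[OF subset_insertI] by (intro measure_pmf.finite_measure_mono) auto
  have "p' * ?P p' (\<lambda>\<omega>. Q (insert e \<omega>)) + (1 - p') * ?P p' Q
      \<le> p' * ?P p (\<lambda>\<omega>. Q (insert e \<omega>)) + (1 - p') * ?P p Q"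
    using 1 2 assms(2-4) by (intro add_mono mult_left_mono) auto
  also have "\<dots> \<le> p * ?P p (\<lambda>\<omega>. Q (insert e \<omega>)) + (1 - p) * ?P p Q"
    using mult_right_mono[OF assms(3), of "?P p Q - ?P p (\<lambda>\<omega>. Q (insert e \<omega>))"] 3
    by (simp add: algebra_simps)
  finally show ?case
    unfolding prob_percolation_insert[OF insert.hyps order_trans[OF assms(2,3)] assms(4)]
      prob_percolation_insert[OF insert.hyps assms(2) order_trans[OF assms(3,4)]] .
qed

section \<open>The critical window\<close>

lemma prob_percolated_regular_graph_le:
  assumes "regular_graphs d n \<noteq> {}"
    and "\<And>G. G \<in> regular_graphs d n \<Longrightarrow> measure_pmf.prob (percolation p G) U \<le> B"
  shows "measure_pmf.prob (percolated_regular_graph d n p) U \<le> B"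
proof -
  let ?X = "regular_graphs d n"
  have c: "0 < real (card ?X)" using assms(1) finite_regular_graphs by (simp add: card_gt_0_iff)
  have "(\<Sum>G\<in>?X. measure_pmf.prob (percolation p G) U) \<le> real (card ?X) * B"
    using sum_bounded_above[of ?X "\<lambda>G. measure_pmf.prob (percolation p G) U" B] assms(2) by blast
  then show ?thesis
    unfolding prob_percolated_regular_graph[OF assms(1)] using c by (simp add: divide_le_eq mult.commute)
qed

lemma prob_percolated_regular_graph_antimono:
  assumes ne: "regular_graphs d n \<noteq> {}" and p: "0 \<le> p" "p \<le> p'" "p' \<le> 1" and n: "n > 0"
  shows "measure_pmf.prob (percolated_regular_graph d n p') {H. largest_component n H < A}
    \<le> measure_pmf.prob (percolated_regular_graph d n p) {H. largest_component n H < A}"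
  unfolding prob_percolated_regular_graph[OF ne]
proof (intro divide_right_mono sum_mono prob_percolation_antimono[OF _ p])
  show "finite G" if "G \<in> regular_graphs d n" for G
    using that finite_simple_graph by (auto simp: regular_graphs_def)
  show "largest_component n \<omega> < A" if "\<omega> \<subseteq> \<omega>'" "largest_component n \<omega>' < A" for \<omega> \<omega>'
    using largest_component_mono[OF n that(1)] that(2) by simp
qed simp

lemma prob_largest_component_gt:
  assumes d: "d = Suc r" "r \<ge> 2" and ne: "regular_graphs d n \<noteq> {}" and n: "n > 0"
    and p: "0 < p" "p < 1" "\<bar>p - 1 / real r\<bar> \<le> e" "e \<le> 1 / (2 * real r)"
    and x: "x \<ge> 4" and t: "t = 2 / sqrt (x / 2) + 4 * (real r)\<^sup>2 * e" "t \<le> 1"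
  shows "measure_pmf.prob (percolated_regular_graph d n p) {H. x < real (largest_component n H)}
    \<le> 2 * real d * (real n * t / x)"
proof (rule prob_percolated_regular_graph_le[OF ne])
  fix G assume G: "G \<in> regular_graphs d n"
  \<comment> \<open>A size above \<open>x\<close> is at least \<open>Suc k\<close>, and
    \<open>k \<ge> x / 2\<close> lets the tail bound at \<open>k\<close> be expressed through
    \<open>t\<close>.\<close>
  define k where "k = nat \<lfloor>x\<rfloor>"
  have k: "k \<ge> 2" "x \<le> real (Suc k)" "x / 2 \<le> real k"
    using x unfolding k_def by linarith+
  define t' where "t' = 2 / sqrt (real k) + 4 * (real r)\<^sup>2 * e"
  have e: "0 \<le> e" using p(3) by linarith
  have "2 / sqrt (real k) \<le> 2 / sqrt (x / 2)"
    using k x by (intro divide_left_mono) auto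
  then have t': "t' \<le> t" unfolding t'_def t by simp
  have "1 / (2 * real r) \<le> p" "p \<le> 1 / real r + e" using p(3,4) by (auto simp: field_simps)
  then have "progeny_tail p r k (Suc r) \<le> 2 * real (Suc r) * t'"
    using d(2) p e k(1) t' t(2) by (intro progeny_tail_upper[OF d(2) _ _ _ e k(1) t'_def]) auto
  also have "\<dots> \<le> 2 * real d * t" using t' unfolding d(1) by (intro mult_left_mono) auto
  finally have T: "progeny_tail p r k (Suc r) \<le> 2 * real d * t" .
  let ?P = "measure_pmf.prob (percolation p G)"
  have "{H. x < real (largest_component n H)} \<subseteq> {H. Suc k \<le> largest_component n H}"
    using x unfolding k_def by (auto simp: Suc_le_eq nat_less_iff) linarith
  then have "?P {H. x < real (largest_component n H)} \<le> ?P {H. Suc k \<le> largest_component n H}"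
    by (intro measure_pmf.finite_measure_mono) auto
  then have "x * ?P {H. x < real (largest_component n H)}
      \<le> real (Suc k) * ?P {H. Suc k \<le> largest_component n H}"
    using k(2) x by (intro mult_mono) auto
  also have "\<dots> \<le> real n * progeny_tail p r k (Suc r)"
    using G p n unfolding d(1) by (intro prob_largest_component_le) auto
  also have "\<dots> \<le> real n * (2 * real d * t)" using T by (intro mult_left_mono) auto
  finally show "?P {H. x < real (largest_component n H)} \<le> 2 * real d * (real n * t / x)"
    using x by (simp add: field_simps)
qed

lemma prob_largest_component_lt:
  assumes d: "d = Suc r" "r \<ge> 2" and ne: "regular_graphs d n \<noteq> {}"
    and p: "1 / real r - e \<le> p" "p < 1"
    and e: "0 < e" "e \<le> 1 / (2 * real r)" and l: "1 \<le> l" "real n * e ^ 3 = l ^ 3"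
    and c: "0 < c" "\<And>k. real k * e\<^sup>2 \<le> 1 \<Longrightarrow> c * e \<le> progeny_tail (1 / real r - 2 * e) r k d"
    and small: "real (2 * d + 1) * e \<le> l" "real (2 * (d * Suc d)) \<le> real n"
      "2 * real ((2 * d + 1) * d * d) \<le> l"
  shows "measure_pmf.prob (percolated_regular_graph d n p) {H. real (largest_component n H) < 1 / e\<^sup>2}
    \<le> exp (- c * l) + 4 * real d / l"
proof -
  define A where "A = nat \<lceil>1 / e\<^sup>2\<rceil>"
  define pl where "pl = 1 / real r - e"
  define p' where "p' = 1 / real r - 2 * e"
  \<comment> \<open>Since \<open>1 - pl * r = r * e\<close>, this solves
    \<open>\<mu> = pl * (1 + r * \<mu>)\<close>.\<close>
  define \<mu> where "\<mu> = pl / (real r * e)"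
  define s where "s = l\<^sup>2 / e\<^sup>2"
  define \<eta> where "\<eta> = e / 2"
  have r: "real r \<ge> 2" using d(2) by simp
  have ie: "0 < 1 / e\<^sup>2" using e by simp
  have A: "A > 0" "1 / e\<^sup>2 \<le> real A" "real (A - 1) \<le> 1 / e\<^sup>2"
    using ie unfolding A_def by linarith+
  have "1 / real r \<le> 1 / 2" "1 / (2 * real r) = 1 / real r / 2" using r by simp_all
  then have pl: "0 \<le> p'" "0 \<le> pl" "pl \<le> 1 / 2" "pl \<le> 1 / real r"
    using e unfolding pl_def p'_def by linarith+
  have n: "real n > 0" using l e by (smt (verit) mult_nonpos_nonneg zero_less_power)
  \<comment> \<open>The critical scaling gives \<open>s / n = e / l\<close>: the explored fraction
    of the graph is small compared with \<open>e\<close> once \<open>l\<close> is large.\<close>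
  have ns: "s * l = real n * e"
  proof -
    have "s * l * e\<^sup>2 = l ^ 3" using e by (simp add: s_def power2_eq_square power3_eq_cube)
    also have "\<dots> = real n * e * e\<^sup>2" using l(2) by (simp add: power2_eq_square power3_eq_cube)
    finally show ?thesis using e by simp
  qed
  have s: "s > 0" using l e by (simp add: s_def)
  have small': "real (2 * d + 1) * s \<le> real n"
  proof -
    have "real (2 * d + 1) * s * l = real (2 * d + 1) * e * real n" using ns by simp
    also have "\<dots> \<le> l * real n" using small(1) n by (intro mult_right_mono) auto
    finally show ?thesis using l by simp
  qed
  interpret ex: exploration d r n A pl p' \<eta> \<mu> s
  proof
    show "pl + pl * \<mu> * real r = \<mu>"
    proof -
      have "\<mu> * (real r * e) = pl" using e r by (simp add: \<mu>_def)
      moreover have "pl * real r = 1 - real r * e" using r by (simp add: pl_def field_simps)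
      moreover have "pl * \<mu> * real r = \<mu> * (pl * real r)" by simp
      ultimately show ?thesis by (simp add: right_diff_distrib)
    qed
    show "real n + 2 * real d * s + real (2 * (d * Suc d)) \<le> real (n * d)"
    proof -
      have "2 * real d * s \<le> real n" using small' s by (simp add: algebra_simps)
      moreover have "real n * 3 \<le> real n * real d" using d n by (intro mult_left_mono) auto
      ultimately show ?thesis using small(2) by simp
    qed
    show "real ((2 * d + 1) * d * d) * s \<le> \<eta> * real n"
    proof -
      have "real ((2 * d + 1) * d * d) * s \<le> l / 2 * s" using small(3) s by (intro mult_right_mono) auto
      also have "\<dots> = \<eta> * real n" using ns by (simp add: \<eta>_def mult.commute)
      finally show ?thesis .
    qed
  qed (use d A pl e small' s r in \<open>auto simp: \<eta>_def \<mu>_def p'_def pl_def\<close>)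
  define j where "j = nat \<lceil>l / e\<rceil>"
  have "1 / (2 * real r) \<le> 1" using r by simp
  then have "e \<le> l" using l(1) e(2) by linarith
  then have le: "1 \<le> l / e" using e by simp
  have j: "l / e \<le> real j" "real j \<le> 2 * (l / e)" using le unfolding j_def by linarith+
  \<comment> \<open>The ceiling \<open>A\<close> may exceed \<open>1 / e\<^sup>2\<close>, but the
    number \<open>A - 1\<close> of required descendants does not.\<close>
  have "c * e \<le> ex.success"
    unfolding ex.success_def unfolding p'_def using A(3) e by (intro c(2)) (simp add: field_simps)
  then have "(1 - ex.success) ^ j \<le> exp (- (c * e)) ^ j"
    using ex.success_bounds exp_ge_add_one_self[of "- (c * e)"] by (intro power_mono) auto
  also have "\<dots> = exp (- (c * e) * real j)" by (simp flip: exp_of_nat_mult add: mult.commute)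
  also have "\<dots> \<le> exp (- c * l)"
    using j(1) c(1) e by (simp add: field_simps)
  finally have 1: "(1 - ex.success) ^ j \<le> exp (- c * l)" .
  have 2: "(real j + \<mu> * (real j * real d)) / s \<le> 4 * real d / l"
  proof -
    have "\<mu> * e = pl / real r" using e by (simp add: \<mu>_def)
    also have "\<dots> \<le> 1 / 1" using pl r by (intro frac_le) auto
    finally have "\<mu> * e * real d \<le> 1 * real d" by (intro mult_right_mono) auto
    moreover have "1 / (2 * real r) \<le> 1" using r by simp
    then have "e \<le> real d" using e(2) d by linarith
    ultimately have "(1 + \<mu> * real d) * e \<le> 2 * real d" by (simp add: algebra_simps)
    with j(2) have "real j * ((1 + \<mu> * real d) * e) \<le> 2 * (l / e) * (2 * real d)"
      by (rule mult_mono) (use l e ex.mu in auto)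
    then have "(real j + \<mu> * (real j * real d)) * e * e \<le> 2 * (l / e) * (2 * real d) * e"
      using e by (intro mult_right_mono) (simp_all add: algebra_simps)
    also have "\<dots> = 4 * real d / l * (s * e * e)"
      using e l by (simp add: s_def power2_eq_square)
    finally have "(real j + \<mu> * (real j * real d)) * (e * e) \<le> 4 * real d / l * s * (e * e)"
      by (simp only: mult.assoc)
    then have "real j + \<mu> * (real j * real d) \<le> 4 * real d / l * s"
      by (rule mult_right_le_imp_le) (use e in simp)
    then show ?thesis using s by (simp add: divide_le_eq)
  qed
  have "measure_pmf.prob (percolated_regular_graph d n p) {H. real (largest_component n H) < 1 / e\<^sup>2}
      \<le> measure_pmf.prob (percolated_regular_graph d n p) {H. largest_component n H < A}"
    using A(2) by (intro measure_pmf.finite_measure_mono) auto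
  also have "\<dots> \<le> measure_pmf.prob (percolated_regular_graph d n pl) {H. largest_component n H < A}"
    using pl p n by (intro prob_percolated_regular_graph_antimono[OF ne]) (auto simp: pl_def)
  also have "\<dots> \<le> (1 - ex.success) ^ j + (real j + \<mu> * (real j * real d)) / s"
    by (rule ex.prob_largest_component_less[OF ne])
  finally show ?thesis using 1 2 by linarith
qed

section \<open>Asymptotics of the scales\<close>

lemma scaling_limits:
  fixes a b :: real
  assumes a: "a > 0" and b: "b > a"
  shows "(\<lambda>n. real n powr (-1/3) * ln (real n) powr a) \<longlonglongrightarrow> 0"
    and "filterlim (\<lambda>n. ln (real n) powr a) at_top sequentially"
    and "filterlim (\<lambda>n. real n powr (2/3) * ln (real n) powr b) at_top sequentially"
    and "(\<lambda>n. ln (real n) powr (a - b)) \<longlonglongrightarrow> 0"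
    and "(\<lambda>n. ln (real n) powr (- (3 * b / 2))) \<longlonglongrightarrow> 0"
proof -
  have ln: "filterlim (\<lambda>n. ln (real n)) at_top sequentially" by real_asymp
  show "(\<lambda>n. real n powr (-1/3) * ln (real n) powr a) \<longlonglongrightarrow> 0" by real_asymp
  show "filterlim (\<lambda>n. ln (real n) powr a) at_top sequentially" using a by real_asymp
  show "filterlim (\<lambda>n. real n powr (2/3) * ln (real n) powr b) at_top sequentially" by real_asymp
  show "(\<lambda>n. ln (real n) powr (a - b)) \<longlonglongrightarrow> 0"
    using b by (intro tendsto_neg_powr[OF _ ln]) simp
  show "(\<lambda>n. ln (real n) powr (- (3 * b / 2))) \<longlonglongrightarrow> 0"
    using a b by (intro tendsto_neg_powr[OF _ ln]) simp
qed

text \<open>The last two ratios are the contributions of the drift and of the critical tail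
  \<open>1 / sqrt x\<close> to the upper bound; \<open>n * e ^ 3\<close> is what the lower bound
  requires.\<close>

lemma scaling_identities:
  fixes a b :: real and n :: nat
  assumes n: "n \<ge> 3"
  defines "L \<equiv> ln (real n)" and "e \<equiv> real n powr (-1/3) * ln (real n) powr a"
    and "x \<equiv> real n powr (2/3) * ln (real n) powr b"
  shows "L > 0" "e > 0" "real n * e ^ 3 = (L powr a) ^ 3"
    and "1 / e\<^sup>2 = real n powr (2/3) * L powr (- 2 * a)"
    and "real n * e / x = L powr (a - b)"
    and "real n * (2 / sqrt (x / 2)) / x = 2 * sqrt 2 * L powr (- (3 * b / 2))"
proof -
  have n0: "real n > 0" using n by simp
  show L: "L > 0" using n by (simp add: L_def)
  show e: "e > 0" using n0 L by (simp add: e_def L_def)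
  have e_pow: "e ^ k = real n powr (- real k / 3) * (L powr a) ^ k" for k
    using n0 by (simp add: e_def L_def power_mult_distrib powr_power)
  show "real n * e ^ 3 = (L powr a) ^ 3"
    unfolding e_pow using n0 by (simp add: powr_minus)
  have "e\<^sup>2 * (real n powr (2/3) * L powr (- 2 * a))
      = (real n powr (- 2 / 3) * real n powr (2 / 3)) * (L powr (2 * a) * L powr (- 2 * a))"
    unfolding e_pow using L by (simp add: powr_power mult.commute[of a])
  also have "\<dots> = 1" using n0 L by (simp flip: powr_add)
  finally show "1 / e\<^sup>2 = real n powr (2/3) * L powr (- 2 * a)" using e by (simp add: field_simps)
  have "real n * e = real n powr (2/3) * L powr a"
    using n0 powr_add[of "real n" 1 "-1/3"] by (simp add: e_def L_def)
  then show "real n * e / x = L powr (a - b)"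
    using n0 L by (simp add: x_def L_def powr_diff)
  have x: "x > 0" using n0 L by (simp add: x_def L_def)
  have "x * sqrt x = x powr (3 / 2)"
    using x powr_add[of x 1 "1/2"] by (simp add: powr_half_sqrt)
  also have "\<dots> = real n * L powr (3 * b / 2)"
    using n0 L by (simp add: x_def L_def powr_mult powr_powr mult.commute)
  finally have xs: "x * sqrt x = real n * L powr (3 * b / 2)" .
  have "real n * (2 / sqrt (x / 2)) / x = 2 * sqrt 2 * (real n / (x * sqrt x))"
    using x by (simp add: real_sqrt_divide mult.commute)
  also have "\<dots> = 2 * sqrt 2 * L powr (- (3 * b / 2))"
    unfolding xs using n0 L by (simp add: powr_minus divide_simps)
  finally show "real n * (2 / sqrt (x / 2)) / x = 2 * sqrt 2 * L powr (- (3 * b / 2))" .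
qed

theorem theorem2:
  fixes d :: nat and p :: "nat \<Rightarrow> real" and a b :: real
  assumes "d \<ge> 3"
    and "\<And>n. n \<in> admissible d \<Longrightarrow> p n \<in> {0<..<1}"
    and "a > 0"
    and "\<And>n. n \<in> admissible d \<Longrightarrow>
           real n powr (1/3) * \<bar>p n - 1 / (real d - 1)\<bar> \<le> ln (real n) powr a"
    and "b > max a (1/3)"
  shows "((\<lambda>n. measure_pmf.prob (percolated_regular_graph d n (p n))
            {H. real n powr (2/3) * ln (real n) powr (- 2 * a) \<le> real (largest_component n H) \<and>
                real (largest_component n H) \<le> real n powr (2/3) * ln (real n) powr b})
          \<longlongrightarrow> 1) (inf sequentially (principal (admissible d)))"
proof -
  let ?F = "inf sequentially (principal (admissible d))"
  define r where "r = d - 1"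
  have r: "d = Suc r" "r \<ge> 2" using assms(1) by (auto simp: r_def)
  have ab: "b > a" using assms(5) by simp
  obtain c e0 where c: "c > 0" "e0 > 0"
    "\<And>e k. \<lbrakk>0 < e; e < e0; real k * e\<^sup>2 \<le> 1\<rbrakk>
      \<Longrightarrow> c * e \<le> progeny_tail (1 / real r - 2 * e) r k (Suc r)"
    using progeny_tail_lower[OF r(2)] by blast
  \<comment> \<open>\<open>u1\<close> and \<open>u2\<close> bound the probabilities that the largest
    component is too large and too small, respectively.\<close>
  define L e l x t u1 u2 where "L = (\<lambda>n::nat. ln (real n))"
    and "e = (\<lambda>n. real n powr (-1/3) * L n powr a)" and "l = (\<lambda>n. L n powr a)"
    and "x = (\<lambda>n. real n powr (2/3) * L n powr b)"
    and "t = (\<lambda>n. 2 / sqrt (x n / 2) + 4 * (real r)\<^sup>2 * e n)"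
    and "u1 = (\<lambda>n. 2 * real d * (2 * sqrt 2 * L n powr (- (3 * b / 2)) + 4 * (real r)\<^sup>2 * L n powr (a - b)))"
    and "u2 = (\<lambda>n. exp (- c * l n) + 4 * real d / l n)"
  have lims: "e \<longlonglongrightarrow> 0" "filterlim l at_top sequentially" "filterlim x at_top sequentially"
    "(\<lambda>n. L n powr (a - b)) \<longlonglongrightarrow> 0" "(\<lambda>n. L n powr (- (3 * b / 2))) \<longlonglongrightarrow> 0"
    using scaling_limits[OF assms(3) ab] unfolding e_def l_def x_def L_def by blast+
  have u1: "u1 \<longlonglongrightarrow> 2 * real d * (2 * sqrt 2 * 0 + 4 * (real r)\<^sup>2 * 0)"
    unfolding u1_def by (intro tendsto_mult tendsto_add tendsto_const lims)
  have "(\<lambda>n. exp (- c * l n)) \<longlonglongrightarrow> 0"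
    using c(1) lims(2) by (intro filterlim_compose[OF exp_at_bot] filterlim_tendsto_neg_mult_at_bot[OF tendsto_const]) auto
  moreover have "(\<lambda>n. 4 * real d / l n) \<longlonglongrightarrow> 0"
    using lims(2) by (intro real_tendsto_divide_at_top[OF tendsto_const])
  ultimately have u2: "u2 \<longlonglongrightarrow> 0 + 0" unfolding u2_def by (intro tendsto_add)
  have t: "t \<longlonglongrightarrow> 0 + 4 * (real r)\<^sup>2 * 0"
    unfolding t_def
  proof (intro tendsto_add tendsto_mult tendsto_const lims)
    have "filterlim (\<lambda>n. 1 / 2 * x n) at_top sequentially"
      by (rule filterlim_tendsto_pos_mult_at_top[OF tendsto_const _ lims(3)]) simp
    then have "filterlim (\<lambda>n. sqrt (x n / 2)) at_top sequentially"
      by (intro filterlim_compose[OF sqrt_at_top]) simp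
    then show "(\<lambda>n. 2 / sqrt (x n / 2)) \<longlonglongrightarrow> 0" by (intro real_tendsto_divide_at_top[OF tendsto_const])
  qed
  have el: "(\<lambda>n. real (2 * d + 1) * e n) \<longlonglongrightarrow> real (2 * d + 1) * 0"
    by (intro tendsto_mult tendsto_const lims)
  have ev: "eventually (\<lambda>n. n \<ge> 3 \<and> e n < min e0 (1 / (2 * real r)) \<and> x n \<ge> 4 \<and> t n \<le> 1 \<and> l n \<ge> 1 \<and>
      real (2 * d + 1) * e n \<le> 1 \<and> real (2 * (d * Suc d)) \<le> real n \<and>
      2 * real ((2 * d + 1) * d * d) \<le> l n) sequentially"
  proof (intro eventually_conj)
    show "eventually (\<lambda>n. n \<ge> 3) sequentially" by (rule eventually_ge_at_top)
    show "eventually (\<lambda>n. e n < min e0 (1 / (2 * real r))) sequentially"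
      using lims(1) c(2) r(2) by (intro order_tendstoD(2)) auto
    show "eventually (\<lambda>n. x n \<ge> 4) sequentially"
      using lims(3) unfolding filterlim_at_top by blast
    show "eventually (\<lambda>n. t n \<le> 1) sequentially"
      using order_tendstoD(2)[OF t, of 1] by (auto elim: eventually_mono)
    show "eventually (\<lambda>n. l n \<ge> 1) sequentially" "eventually (\<lambda>n. 2 * real ((2 * d + 1) * d * d) \<le> l n) sequentially"
      using lims(2) unfolding filterlim_at_top by blast+
    show "eventually (\<lambda>n. real (2 * d + 1) * e n \<le> 1) sequentially"
      using order_tendstoD(2)[OF el, of 1] by (auto elim: eventually_mono)
    show "eventually (\<lambda>n. real (2 * (d * Suc d)) \<le> real n) sequentially"
      using eventually_ge_at_top[of "2 * (d * Suc d)"] by eventually_elim (simp only: of_nat_le_iff)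
  qed
  let ?E = "\<lambda>n. {H. real n powr (2/3) * ln (real n) powr (- 2 * a) \<le> real (largest_component n H) \<and>
                real (largest_component n H) \<le> real n powr (2/3) * ln (real n) powr b}"
  let ?P = "\<lambda>n. measure_pmf.prob (percolated_regular_graph d n (p n))"
  \<comment> \<open>The scale estimates hold for all large \<open>n\<close>; the hypotheses on
    \<open>p n\<close> and the existence of regular graphs enter for admissible
    \<open>n\<close>.\<close>
  have lower: "eventually (\<lambda>n. 1 - (u1 n + u2 n) \<le> ?P n (?E n)) ?F"
    unfolding eventually_inf_principal using ev
  proof eventually_elim
    case (elim n)
    show ?case
    proof
      assume adm: "n \<in> admissible d"
      have n: "n \<ge> 3" "n > 0" using elim by auto
      have id: "L n > 0" "e n > 0" "real n * e n ^ 3 = l n ^ 3"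
        "1 / (e n)\<^sup>2 = real n powr (2/3) * ln (real n) powr (- 2 * a)"
        "real n * e n / x n = L n powr (a - b)"
        "real n * (2 / sqrt (x n / 2)) / x n = 2 * sqrt 2 * L n powr (- (3 * b / 2))"
        unfolding L_def e_def l_def x_def by (rule scaling_identities[OF n(1)])+
      have ne: "regular_graphs d n \<noteq> {}"
        using adm by (intro regular_graphs_nonempty) (auto simp: admissible_def)
      have p: "0 < p n" "p n < 1" using assms(2)[OF adm] by auto
      have cancel: "real n powr (-1/3) * (real n powr (1/3) * y) = y" for y
        using n by (simp add: powr_minus)
      have "real n powr (-1/3) * (real n powr (1/3) * \<bar>p n - 1 / (real d - 1)\<bar>) \<le> e n"
        unfolding e_def L_def using assms(4)[OF adm] by (intro mult_left_mono) auto
      then have pe: "\<bar>p n - 1 / real r\<bar> \<le> e n" unfolding cancel using r(1) by simp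
      have el: "e n < e0" "e n \<le> 1 / (2 * real r)" using elim by auto
      have U: "?P n {H. x n < real (largest_component n H)} \<le> u1 n"
      proof -
        have "?P n {H. x n < real (largest_component n H)} \<le> 2 * real d * (real n * t n / x n)"
          using elim by (intro prob_largest_component_gt[OF r ne n(2) p pe el(2)]) (auto simp: t_def)
        also have "real n * t n / x n = real n * (2 / sqrt (x n / 2)) / x n + 4 * (real r)\<^sup>2 * (real n * e n / x n)"
          unfolding t_def by (simp add: distrib_left add_divide_distrib)
        finally show ?thesis unfolding id u1_def .
      qed
      have D: "?P n {H. real (largest_component n H) < 1 / (e n)\<^sup>2} \<le> u2 n"
        unfolding u2_def
      proof (rule prob_largest_component_lt[OF r ne _ p(2) id(2) el(2) _ id(3) c(1)])
        show "1 / real r - e n \<le> p n" using pe by linarith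
        show "1 \<le> l n" "real (2 * (d * Suc d)) \<le> real n" "2 * real ((2 * d + 1) * d * d) \<le> l n"
          using elim by auto
        show "real (2 * d + 1) * e n \<le> l n" using elim by linarith
        show "c * e n \<le> progeny_tail (1 / real r - 2 * e n) r k d" if "real k * (e n)\<^sup>2 \<le> 1" for k
          unfolding r(1) using c(3)[OF id(2) el(1) that] .
      qed
      have "- ?E n \<subseteq> {H. x n < real (largest_component n H)} \<union> {H. real (largest_component n H) < 1 / (e n)\<^sup>2}"
        unfolding id(4) x_def L_def by auto
      then have "?P n (- ?E n) \<le> ?P n ({H. x n < real (largest_component n H)} \<union> {H. real (largest_component n H) < 1 / (e n)\<^sup>2})"
        by (intro measure_pmf.finite_measure_mono) auto
      also have "\<dots> \<le> ?P n {H. x n < real (largest_component n H)} + ?P n {H. real (largest_component n H) < 1 / (e n)\<^sup>2}"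
        by (rule measure_Un_le) auto
      also have "\<dots> \<le> u1 n + u2 n" using U D by (rule add_mono)
      finally show "1 - (u1 n + u2 n) \<le> ?P n (?E n)"
        using measure_pmf.prob_compl[of "?E n" "percolated_regular_graph d n (p n)"]
        by (simp add: Compl_eq_Diff_UNIV)
    qed
  qed
  have "(\<lambda>n. 1 - (u1 n + u2 n)) \<longlonglongrightarrow> 1 - (0 + 0)"
    using u1 u2 by (intro tendsto_intros) auto
  then have lim: "((\<lambda>n. 1 - (u1 n + u2 n)) \<longlongrightarrow> 1) ?F"
    by (intro tendsto_mono[OF inf_le1]) simp
  show ?thesis
    by (rule tendsto_sandwich[OF lower _ lim tendsto_const]) simp
qed

end
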